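(* Let $Y$ be a finite connected graph on which a finite abelian group $G$ acts without inversion and freely on directed edges. If $\chi(Y)\ne0$, then $\mathrm{ord}_{u=1}h(u,\psi)=0$ for every non-trivial character $\psi\in\widehat G$, and $\mathrm{ord}_{u=1}h(u,\psi_0)=1$ for the trivial character $\psi_0$.
   Context: Graphs in Serre's sense (vertices $V_Y$, directed edges $\mathbf{E}_Y$, maps $o,t$, fixed-point-free involution $\varepsilon\mapsto\bar\varepsilon$ with $o(\bar\varepsilon)=t(\varepsilon)$); $\chi(Y)=|V_Y|-|E_Y|$ ($E_Y$ undirected edges); $\mathrm{val}_Y(w)=|\{\varepsilon:o(\varepsilon)=w\}|$. Without inversion: $\sigma\varepsilon\ne\bar\varepsilon$. $C_0(Y)=\mathbb{C}V_Y$ as $\mathbb{C}[G]$-module, $\mathcal{D}(w)=\mathrm{val}_Y(w)w$, $\mathcal{A}(w)=\sum_{o(\varepsilon)=w}t(\varepsilon)$, $\eta_Y(u)=\det_{\mathbb{C}[G][u]}(\mathcal{I}-\mathcal{A}u+(\mathcal{D}-\mathcal{I})u^2)$ on $C_0(Y)[u]$ (determinant of an endomorphism $f$ of a finitely generated projective module $M$ defined as $\det(f\oplus\mathrm{id}_N)$ with $M\oplus N$ free). $\widehat G$ = homomorphisms $G\to\mathbb{C}^\times$; $h(u,\psi)=\psi(\eta_Y(u))\in\mathbb{C}[u]$, $\psi$ extended linearly and coefficientwise. *)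

theory Defs
  imports
    "HOL-Library.Poly_Mapping"
    "HOL-Library.Extended_Nat"
    "Graph_Theory.Graph_Theory"
    "Jordan_Normal_Form.VS_Connect"
    "Jordan_Normal_Form.Determinant"
begin

section \<open>Graphs in the sense of Serre\<close>

text \<open>
  A graph in the sense of Serre is a \<^locale>\<open>bidirected_digraph\<close>: \<^const>\<open>arcs\<close> are the directed
  edges, \<^const>\<open>tail\<close> and \<^const>\<open>head\<close> are \<open>o\<close> and \<open>t\<close>, and the reversal map is the involution
  \<open>\<epsilon> \<mapsto> \<epsilon>\<^sup>-\<close>, without fixed points on the arcs (and, by the convention of that locale, the identity
  off the arcs). Loops and multiple edges are allowed. The valency of \<open>w\<close> is \<^term>\<open>out_degree Y w\<close>.
\<close>

definition undirected_edges :: "('v, 'e) pre_digraph \<Rightarrow> ('e \<Rightarrow> 'e) \<Rightarrow> 'e set set" where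
  "undirected_edges Y bar = (\<lambda>e. {e, bar e}) ` arcs Y"

definition euler_char :: "('v, 'e) pre_digraph \<Rightarrow> ('e \<Rightarrow> 'e) \<Rightarrow> int" where
  "euler_char Y bar = int (card (verts Y)) - int (card (undirected_edges Y bar))"

text \<open>The abelian group \<open>G\<close> is written additively throughout.\<close>

locale graph_action = bidirected_digraph Y bar
  for Y :: "('v, 'e) pre_digraph" and bar :: "'e \<Rightarrow> 'e" +
  fixes actV :: "'g::ab_group_add \<Rightarrow> 'v \<Rightarrow> 'v"
    and actE :: "'g \<Rightarrow> 'e \<Rightarrow> 'e"
  assumes actV_closed: "w \<in> verts Y \<Longrightarrow> actV g w \<in> verts Y"
    and actV_zero: "w \<in> verts Y \<Longrightarrow> actV 0 w = w"
    and actV_add: "w \<in> verts Y \<Longrightarrow> actV (g + h) w = actV g (actV h w)"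
    and actE_closed: "e \<in> arcs Y \<Longrightarrow> actE g e \<in> arcs Y"
    and actE_zero: "e \<in> arcs Y \<Longrightarrow> actE 0 e = e"
    and actE_add: "e \<in> arcs Y \<Longrightarrow> actE (g + h) e = actE g (actE h e)"
    and tail_actE: "e \<in> arcs Y \<Longrightarrow> tail Y (actE g e) = actV g (tail Y e)"
    and head_actE: "e \<in> arcs Y \<Longrightarrow> head Y (actE g e) = actV g (head Y e)"
    and bar_actE: "e \<in> arcs Y \<Longrightarrow> bar (actE g e) = actE g (bar e)"

definition without_inversion ::
  "('v, 'e) pre_digraph \<Rightarrow> ('e \<Rightarrow> 'e) \<Rightarrow> ('g \<Rightarrow> 'e \<Rightarrow> 'e) \<Rightarrow> bool" where
  "without_inversion Y bar actE \<longleftrightarrow> (\<forall>g. \<forall>e\<in>arcs Y. actE g e \<noteq> bar e)"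

definition free_on_arcs ::
  "('v, 'e) pre_digraph \<Rightarrow> ('g::zero \<Rightarrow> 'e \<Rightarrow> 'e) \<Rightarrow> bool" where
  "free_on_arcs Y actE \<longleftrightarrow> (\<forall>g. \<forall>e\<in>arcs Y. actE g e = e \<longrightarrow> g = 0)"


section \<open>Determinants of endomorphisms of finitely generated projective modules\<close>

text \<open>
  \<open>d\<close> is the determinant of \<open>f \<oplus> id\<^sub>N\<close> on the free module \<open>M \<oplus> N\<close>, computed as the determinant of the
  matrix \<open>A\<close> of \<open>f \<oplus> id\<^sub>N\<close> in the basis of \<open>M \<oplus> N\<close> given by an isomorphism \<open>\<phi>\<close> onto \<open>R\<^sup>n\<close>. As \<open>N\<close>
  embeds into \<open>R\<^sup>n\<close>, it is no restriction that the elements of \<open>N\<close> are taken in \<^typ>\<open>'r vec\<close>.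
\<close>

definition is_proj_det ::
  "('r::comm_ring_1, 'm) module \<Rightarrow> ('m \<Rightarrow> 'm) \<Rightarrow> 'r \<Rightarrow> bool" where
  "is_proj_det M f d \<longleftrightarrow>
     Module.module class_ring M \<and> f \<in> LinearCombinations.module_hom class_ring M M \<and>
     (\<exists>(N :: ('r, 'r vec) module) n \<phi> A.
        Module.module class_ring N \<and>
        \<phi> \<in> LinearCombinations.module_hom class_ring (direct_sum M N) (module_vec TYPE('r) n) \<and>
        bij_betw \<phi> (carrier (direct_sum M N)) (carrier_vec n) \<and>
        A \<in> carrier_mat n n \<and>
        (\<forall>x\<in>carrier M. \<forall>y\<in>carrier N. \<phi> (f x, y) = A *\<^sub>v \<phi> (x, y)) \<and>
        d = Determinant.det A)"

definition proj_det ::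
  "('r::comm_ring_1, 'm) module \<Rightarrow> ('m \<Rightarrow> 'm) \<Rightarrow> 'r" where
  "proj_det M f = (THE d. is_proj_det M f d)"


section \<open>The module of vertex chains\<close>

text \<open>
  \<open>\<complex>[G]\<close> is \<^typ>\<open>'g \<Rightarrow>\<^sub>0 complex\<close>, whose multiplication is convolution, and \<open>\<complex>[G][u]\<close> is
  \<^typ>\<open>('g \<Rightarrow>\<^sub>0 complex) poly\<close>. Elements of \<open>C\<^sub>0(Y)\<close> are the elements of \<^typ>\<open>'v \<Rightarrow>\<^sub>0 complex\<close> supported
  on the vertices, and those of \<open>C\<^sub>0(Y)[u]\<close> are polynomials with such coefficients.
\<close>

definition grp_alg_scale ::
  "('g \<Rightarrow> 'v \<Rightarrow> 'v) \<Rightarrow> ('g \<Rightarrow>\<^sub>0 complex) \<Rightarrow> ('v \<Rightarrow>\<^sub>0 complex) \<Rightarrow> ('v \<Rightarrow>\<^sub>0 complex)" where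
  "grp_alg_scale actV r x =
     (\<Sum>g\<in>Poly_Mapping.keys r. \<Sum>w\<in>Poly_Mapping.keys x. Poly_Mapping.single (actV g w) (Poly_Mapping.lookup r g * Poly_Mapping.lookup x w))"

definition C0_poly ::
  "('v, 'e) pre_digraph \<Rightarrow> ('g \<Rightarrow> 'v \<Rightarrow> 'v) \<Rightarrow>
     (('g::ab_group_add \<Rightarrow>\<^sub>0 complex) poly, ('v \<Rightarrow>\<^sub>0 complex) poly) module" where
  "C0_poly Y actV =
     \<lparr>carrier = {p. \<forall>i. Poly_Mapping.keys (Polynomial.coeff p i) \<subseteq> verts Y},
      mult = undefined,
      one = undefined,
      zero = 0,
      add = (+),
      smult = (\<lambda>r p. \<Sum>i\<le>degree r. \<Sum>j\<le>degree p.
        Polynomial.monom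
          (grp_alg_scale actV (Polynomial.coeff r i) (Polynomial.coeff p j)) (i + j))\<rparr>"

definition lin_ext ::
  "('v \<Rightarrow> ('v \<Rightarrow>\<^sub>0 complex)) \<Rightarrow> ('v \<Rightarrow>\<^sub>0 complex) \<Rightarrow> ('v \<Rightarrow>\<^sub>0 complex)" where
  "lin_ext T x = (\<Sum>w\<in>Poly_Mapping.keys x. Poly_Mapping.map ((*) (Poly_Mapping.lookup x w)) (T w))"

definition adj_op ::
  "('v, 'e) pre_digraph \<Rightarrow> ('v \<Rightarrow>\<^sub>0 complex) \<Rightarrow> ('v \<Rightarrow>\<^sub>0 complex)" where
  "adj_op Y = lin_ext (\<lambda>w. \<Sum>e\<in>out_arcs Y w. Poly_Mapping.single (head Y e) 1)"

definition val_op ::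
  "('v, 'e) pre_digraph \<Rightarrow> ('v \<Rightarrow>\<^sub>0 complex) \<Rightarrow> ('v \<Rightarrow>\<^sub>0 complex)" where
  "val_op Y = lin_ext (\<lambda>w. Poly_Mapping.single w (of_nat (out_degree Y w)))"

text \<open>\<open>I - A u + (D - I) u\<^sup>2\<close> on \<open>C\<^sub>0(Y)[u]\<close>; \<^term>\<open>pCons 0\<close> is multiplication by \<open>u\<close>.\<close>

definition ihara_op ::
  "('v, 'e) pre_digraph \<Rightarrow> ('v \<Rightarrow>\<^sub>0 complex) poly \<Rightarrow> ('v \<Rightarrow>\<^sub>0 complex) poly" where
  "ihara_op Y p =
     p - pCons 0 (map_poly (adj_op Y) p) + pCons 0 (pCons 0 (map_poly (val_op Y) p - p))"

definition eta ::
  "('v, 'e) pre_digraph \<Rightarrow> ('g::ab_group_add \<Rightarrow> 'v \<Rightarrow> 'v) \<Rightarrow> ('g \<Rightarrow>\<^sub>0 complex) poly" where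
  "eta Y actV = proj_det (C0_poly Y actV) (ihara_op Y)"


section \<open>Characters\<close>

definition is_character :: "('g::ab_group_add \<Rightarrow> complex) \<Rightarrow> bool" where
  "is_character \<psi> \<longleftrightarrow> (\<forall>g. \<psi> g \<noteq> 0) \<and> (\<forall>g h. \<psi> (g + h) = \<psi> g * \<psi> h)"

definition trivial_character :: "'g::ab_group_add \<Rightarrow> complex" where
  "trivial_character = (\<lambda>g. 1)"

definition char_ext :: "('g \<Rightarrow> complex) \<Rightarrow> ('g \<Rightarrow>\<^sub>0 complex) \<Rightarrow> complex" where
  "char_ext \<psi> r = (\<Sum>g\<in>Poly_Mapping.keys r. Poly_Mapping.lookup r g * \<psi> g)"

definition h_poly ::
  "('v, 'e) pre_digraph \<Rightarrow> ('g::ab_group_add \<Rightarrow> 'v \<Rightarrow> 'v) \<Rightarrow> ('g \<Rightarrow> complex) \<Rightarrow> complex poly" where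
  "h_poly Y actV \<psi> = map_poly (char_ext \<psi>) (eta Y actV)"

text \<open>\<^term>\<open>Polynomial.order a p\<close> is unspecified for the zero polynomial, whose order is \<open>\<infinity>\<close>.\<close>

definition ord_at :: "complex \<Rightarrow> complex poly \<Rightarrow> enat" where
  "ord_at a p = (if p = 0 then \<infinity> else enat (Polynomial.order a p))"

end

theory Submission
  imports Defs "Jordan_Normal_Form.Char_Poly"
begin

text \<open>
  The map \<open>v \<mapsto> |G|\<^sup>-\<^sup>1 \<Sum>\<^sub>g g\<^sup>-\<^sup>1 \<otimes> g v\<close> makes \<open>C\<^sub>0(Y)\<close> a direct summand of the free module on the
  vertices, cut out by an idempotent \<open>E\<close>, and \<open>\<eta>\<^sub>Y(u) = det (1 - E + F(u) E)\<close> with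
  \<open>F(u) = I - A u + (D - I) u\<^sup>2\<close>. A character \<open>\<psi>\<close> turns \<open>E\<close> into the projector \<open>E\<^sub>\<psi>\<close> onto an isotypic
  component, which commutes with the Laplacian \<open>F(1) = D - A\<close>. A kernel vector at \<open>u = 1\<close> is therefore
  harmonic and lies in the image of \<open>E\<^sub>\<psi>\<close>; since \<open>Y\<close> is connected it is constant, and it vanishes if \<open>\<psi>\<close>
  is non-trivial. For the trivial character the sum of the rows of \<open>1 - E\<^sub>\<psi> + F(u) E\<^sub>\<psi>\<close> is divisible by \<open>1 - u\<close>;
  after dividing, the constants leave the kernel at \<open>u = 1\<close> because the sum of \<open>2 - val(w)\<close> over all \<open>w\<close>
  is \<open>2 \<chi>(Y)\<close>.
\<close>

section \<open>Determinants over commutative rings\<close>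

text \<open>Freeness on directed edges still allows vertices with non-trivial stabilisers, so
  \<open>C_0(Y)\<close> need not be free over the group algebra. It is projective because the group
  order is invertible in the complex numbers, and averaging over the whole group treats all vertices
  alike, without a choice of orbit representatives. As \<open>proj_det\<close> is a definite
  description, its value can be read off from one complement only once all complements, of whatever
  rank, are known to give the same determinant. This rests on
  \<open>det (1 + X Y) = det (1 + Y X)\<close> for rectangular factors, over a ring that in general
  has zero divisors. In the averaged coordinates the operator has complex coefficients, so the group
  enters only through \<open>E\<close>. In the trivial case the factor comes from
  \<open>1 - d u + (d - 1) u^2 = (1 - u) (1 - (d - 1) u)\<close>, the column sum at a vertex of
  valency \<open>d\<close>; at \<open>u = 1\<close> the cofactor is \<open>2 - d\<close>.\<close>

lemma det_four_block_one_lower_right: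
  fixes B :: "'a::comm_ring_1 mat"
  assumes B: "B \<in> carrier_mat n n" and C: "C \<in> carrier_mat m n"
  shows "Determinant.det (four_block_mat B (0\<^sub>m n m) C (1\<^sub>m m)) = Determinant.det B"
  using C
proof (induction m arbitrary: C)
  case 0
  have "four_block_mat B (0\<^sub>m n 0) C (1\<^sub>m 0) = B"
    using B 0 by (intro eq_matI) auto
  then show ?case by simp
next
  case (Suc m)
  define C' where "C' = mat m n (\<lambda>(i, j). C $$ (i, j))"
  define D where "D = four_block_mat B (0\<^sub>m n m) C' (1\<^sub>m m)"
  define r where "r = mat 1 (n + m) (\<lambda>(i, j). if j < n then C $$ (m, j) else 0)"
  have C': "C' \<in> carrier_mat m n" and D: "D \<in> carrier_mat (n + m) (n + m)"
    and r: "r \<in> carrier_mat 1 (n + m)"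
    using B by (auto simp: C'_def D_def r_def)
  \<comment> \<open>The last column is a unit vector, so the matrix is regrouped with that column
    and the last row as blocks of width one.\<close>
  have "four_block_mat B (0\<^sub>m n (Suc m)) C (1\<^sub>m (Suc m))
      = four_block_mat D (0\<^sub>m (n + m) 1) r (1\<^sub>m 1)"
    using B Suc.prems
    by (intro eq_matI, auto simp: D_def C'_def r_def less_Suc_eq, auto)
  then have "Determinant.det (four_block_mat B (0\<^sub>m n (Suc m)) C (1\<^sub>m (Suc m))) = Determinant.det D"
    using det_four_block_mat_upper_right_zero_col[OF D refl r, of "1\<^sub>m 1"] by simp
  then show ?case using Suc.IH[OF C'] by (simp add: D_def)
qed

text \<open>The first column has the leading 1 as its only non-zero entry, so Laplace expansion
  along it lowers \<open>m\<close> by one.\<close>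

lemma det_four_block_one_upper_left:
  fixes B :: "'a::comm_ring_1 mat"
  assumes B: "B \<in> carrier_mat n n" and C: "C \<in> carrier_mat m n"
  shows "Determinant.det (four_block_mat (1\<^sub>m m) C (0\<^sub>m n m) B) = Determinant.det B"
  using C
proof (induction m arbitrary: C)
  case 0
  have "four_block_mat (1\<^sub>m 0) C (0\<^sub>m n 0) B = B"
    using B 0 by (intro eq_matI) auto
  then show ?case by simp
next
  case (Suc m)
  define A where "A = four_block_mat (1\<^sub>m (Suc m)) C (0\<^sub>m n (Suc m)) B"
  define C' where "C' = mat m n (\<lambda>(i, j). C $$ (Suc i, j))"
  have A: "A \<in> carrier_mat (Suc (m + n)) (Suc (m + n))" using B by (auto simp: A_def)
  have C': "C' \<in> carrier_mat m n" by (auto simp: C'_def)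
  have "mat_delete A 0 0 = four_block_mat (1\<^sub>m m) C' (0\<^sub>m n m) B"
    using B Suc.prems by (intro eq_matI) (auto simp: mat_delete_def A_def C'_def)
  then have del: "Determinant.det (mat_delete A 0 0) = Determinant.det B"
    using Suc.IH[OF C'] by simp
  have "Determinant.det A = (\<Sum>i<Suc (m + n). A $$ (i, 0) * cofactor A i 0)"
    by (rule laplace_expansion_column[OF A]) simp
  also have "\<dots> = (\<Sum>i\<in>{0}. A $$ (i, 0) * cofactor A i 0)"
    using B Suc.prems by (intro sum.mono_neutral_right) (auto simp: A_def)
  also have "\<dots> = Determinant.det (mat_delete A 0 0)"
    using B Suc.prems by (simp add: A_def cofactor_def)
  finally show ?case using del by (simp add: A_def)
qed

text \<open>Both sides are the determinant of the block matrix with blocks \<open>1\<close>, \<open>-X\<close>, \<open>Y\<close>, \<open>1\<close>.\<close>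

lemma det_one_add_mult_commute:
  fixes X :: "'a::comm_ring_1 mat"
  assumes X: "X \<in> carrier_mat m n" and Y: "Y \<in> carrier_mat n m"
  shows "Determinant.det (1\<^sub>m m + X * Y) = Determinant.det (1\<^sub>m n + Y * X)"
proof -
  define K where "K = four_block_mat (1\<^sub>m m) (- X) Y (1\<^sub>m n)"
  have K: "K \<in> carrier_mat (m + n) (m + n)" by (simp add: K_def)
  \<comment> \<open>Unipotent row operations: \<open>?U\<close> clears the upper right block of
    \<open>K\<close> and leaves \<open>1 + X Y\<close>; \<open>?L\<close> clears the lower left
    block and leaves \<open>1 + Y X\<close>.\<close>
  let ?U = "four_block_mat (1\<^sub>m m) X (0\<^sub>m n m) (1\<^sub>m n)"
  let ?L = "four_block_mat (1\<^sub>m m) (0\<^sub>m m n) (- Y) (1\<^sub>m n)"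
  have U: "?U \<in> carrier_mat (m + n) (m + n)" and L: "?L \<in> carrier_mat (m + n) (m + n)" by auto
  have XY: "X * Y \<in> carrier_mat m m" and YX: "Y * X \<in> carrier_mat n n"
    and mX: "- X \<in> carrier_mat m n" and mY: "- Y \<in> carrier_mat n m"
    using X Y by auto
  have "?U * K = four_block_mat (1\<^sub>m m * 1\<^sub>m m + X * Y) (1\<^sub>m m * - X + X * 1\<^sub>m n)
      (0\<^sub>m n m * 1\<^sub>m m + 1\<^sub>m n * Y) (0\<^sub>m n m * - X + 1\<^sub>m n * 1\<^sub>m n)"
    unfolding K_def by (rule mult_four_block_mat) (use X Y in auto)
  also have "\<dots> = four_block_mat (1\<^sub>m m + X * Y) (0\<^sub>m m n) Y (1\<^sub>m n)"
  proof -
    have "- 0\<^sub>m n n + 1\<^sub>m n = (1\<^sub>m n :: 'a mat)" by (intro eq_matI) auto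
    then show ?thesis using X Y XY YX by (simp add: uminus_l_inv_mat)
  qed
  finally have 1: "Determinant.det (?U * K) = Determinant.det (1\<^sub>m m + X * Y)"
    using det_four_block_one_lower_right[of "1\<^sub>m m + X * Y" m Y n] XY Y by simp
  have "?L * K = four_block_mat (1\<^sub>m m * 1\<^sub>m m + 0\<^sub>m m n * Y) (1\<^sub>m m * - X + 0\<^sub>m m n * 1\<^sub>m n)
      (- Y * 1\<^sub>m m + 1\<^sub>m n * Y) (- Y * - X + 1\<^sub>m n * 1\<^sub>m n)"
    unfolding K_def by (rule mult_four_block_mat) (use X Y in auto)
  also have "\<dots> = four_block_mat (1\<^sub>m m) (- X) (0\<^sub>m n m) (1\<^sub>m n + Y * X)"
  proof -
    have "- Y * - X = Y * X" using X Y by (intro eq_matI) auto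
    moreover have "- Y + Y = 0\<^sub>m n m" using Y by (simp add: uminus_l_inv_mat)
    moreover have "Y * X + 1\<^sub>m n = 1\<^sub>m n + Y * X" using YX by (intro comm_add_mat) auto
    ultimately show ?thesis using X Y XY YX by simp
  qed
  finally have 2: "Determinant.det (?L * K) = Determinant.det (1\<^sub>m n + Y * X)"
    using det_four_block_one_upper_left[of "1\<^sub>m n + Y * X" n "- X" m] YX mX by simp
  have "Determinant.det ?U = 1" "Determinant.det ?L = 1"
    using det_four_block_one_upper_left[of "1\<^sub>m n" n X m] X
      det_four_block_one_lower_right[of "1\<^sub>m m" m "- Y" n] mY by auto
  then show ?thesis
    using 1 2 det_mult[OF U K] det_mult[OF L K] by simp
qed

lemma linear_vec_map_eq_mat:
  fixes T :: "'a::comm_ring_1 vec \<Rightarrow> 'a vec"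
  assumes T: "T \<in> carrier_vec n \<rightarrow> carrier_vec m"
    and add: "\<And>v w. v \<in> carrier_vec n \<Longrightarrow> w \<in> carrier_vec n \<Longrightarrow> T (v + w) = T v + T w"
    and smult: "\<And>c v. v \<in> carrier_vec n \<Longrightarrow> T (c \<cdot>\<^sub>v v) = c \<cdot>\<^sub>v T v"
  obtains S where "S \<in> carrier_mat m n" "\<And>v. v \<in> carrier_vec n \<Longrightarrow> S *\<^sub>v v = T v"
proof
  define S where "S = mat m n (\<lambda>(i, j). T (unit_vec n j) $ i)"
  show S: "S \<in> carrier_mat m n" by (simp add: S_def)
  fix v :: "'a vec" assume v: "v \<in> carrier_vec n"
  \<comment> \<open>Truncations of \<open>v\<close>: passing from \<open>t k\<close> to
    \<open>t (Suc k)\<close> adds one multiple of a unit vector, so additivity of \<open>T\<close>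
    builds up the column expansion of \<open>T v\<close>.\<close>
  define t where "t k = vec n (\<lambda>j. if j < k then v $ j else 0)" for k
  have T0: "T (0\<^sub>v n) = 0\<^sub>v m"
  proof -
    have "T (0\<^sub>v n) \<in> carrier_vec m" using T by auto
    then have "0 \<cdot>\<^sub>v T (0\<^sub>v n) = 0\<^sub>v m" by (intro eq_vecI) auto
    moreover have "0 \<cdot>\<^sub>v 0\<^sub>v n = (0\<^sub>v n :: 'a vec)" by (intro eq_vecI) auto
    ultimately show ?thesis using smult[of "0\<^sub>v n" 0] by simp
  qed
  have "T (t k) $ i = (\<Sum>j<k. v $ j * T (unit_vec n j) $ i)" if "k \<le> n" "i < m" for k i
    using \<open>k \<le> n\<close>
  proof (induction k)
    case 0
    have "t 0 = 0\<^sub>v n" by (auto simp: t_def)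
    then show ?case using T0 \<open>i < m\<close> by simp
  next
    case (Suc k)
    have tk: "t k \<in> carrier_vec n" by (simp add: t_def)
    have "t (Suc k) = t k + v $ k \<cdot>\<^sub>v unit_vec n k"
      using Suc.prems by (intro eq_vecI) (auto simp: t_def less_Suc_eq)
    then have "T (t (Suc k)) = T (t k) + v $ k \<cdot>\<^sub>v T (unit_vec n k)"
      using add[OF tk] smult by simp
    moreover have "T (unit_vec n k) \<in> carrier_vec m" using T by auto
    ultimately show ?case using Suc \<open>i < m\<close> by simp
  qed
  from this[of n] have *: "T (t n) $ i = (\<Sum>j<n. v $ j * T (unit_vec n j) $ i)" if "i < m" for i
    using that by simp
  have "t n = v" using v by (auto simp: t_def)
  moreover have "T v \<in> carrier_vec m" using T v by auto
  ultimately show "S *\<^sub>v v = T v"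
    using v * by (intro eq_vecI)
      (auto simp: S_def scalar_prod_def lessThan_atLeast0 mult.commute intro!: sum.cong)
qed

section \<open>Determinants of endomorphisms of projective modules\<close>

lemma mult_mat_vec_smult:
  fixes A :: "'a::comm_ring_1 mat"
  assumes "A \<in> carrier_mat m n" "v \<in> carrier_vec n"
  shows "A *\<^sub>v (c \<cdot>\<^sub>v v) = c \<cdot>\<^sub>v (A *\<^sub>v v)"
  using assms by (intro eq_vecI) auto

lemma mult_mat_vec_uminus:
  fixes A :: "'a::comm_ring_1 mat"
  assumes "A \<in> carrier_mat m n" "v \<in> carrier_vec n"
  shows "A *\<^sub>v (- v) = - (A *\<^sub>v v)"
  using assms by (intro eq_vecI) auto

text \<open>The module laws are equations, so they pull back from \<open>R^n\<close> along an
  injective linear map. Only the additive inverse is an existence claim; it is supplied by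
  \<open>neg\<close>.\<close>

lemma module_if_embeds_in_vec:
  fixes M :: "('r::comm_ring_1, 'm) module"
  assumes zero: "\<zero>\<^bsub>M\<^esub> \<in> carrier M"
    and add: "\<And>x y. x \<in> carrier M \<Longrightarrow> y \<in> carrier M \<Longrightarrow> x \<oplus>\<^bsub>M\<^esub> y \<in> carrier M"
    and smult: "\<And>r x. x \<in> carrier M \<Longrightarrow> r \<odot>\<^bsub>M\<^esub> x \<in> carrier M"
    and emb: "\<And>x. x \<in> carrier M \<Longrightarrow> \<iota> x \<in> carrier_vec n"
    and inj: "inj_on \<iota> (carrier M)"
    and emb_zero: "\<iota> \<zero>\<^bsub>M\<^esub> = 0\<^sub>v n"
    and emb_add: "\<And>x y. x \<in> carrier M \<Longrightarrow> y \<in> carrier M \<Longrightarrow> \<iota> (x \<oplus>\<^bsub>M\<^esub> y) = \<iota> x + \<iota> y"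
    and emb_smult: "\<And>r x. x \<in> carrier M \<Longrightarrow> \<iota> (r \<odot>\<^bsub>M\<^esub> x) = r \<cdot>\<^sub>v \<iota> x"
    and neg: "\<And>x. x \<in> carrier M \<Longrightarrow> \<exists>y\<in>carrier M. \<iota> y = - \<iota> x"
  shows "Module.module class_ring M"
proof (rule module.intro)
  show "cring (class_ring :: 'r ring)" by (rule class_cring.is_cring)
  show "abelian_group M"
  proof (rule abelian_groupI)
    fix x assume x: "x \<in> carrier M"
    then obtain y where "y \<in> carrier M" "\<iota> y = - \<iota> x" using neg by blast
    then have "\<iota> (y \<oplus>\<^bsub>M\<^esub> x) = \<iota> \<zero>\<^bsub>M\<^esub>"
      using x emb[OF x] by (simp add: emb_add emb_zero uminus_l_inv_vec)
    then show "\<exists>y\<in>carrier M. y \<oplus>\<^bsub>M\<^esub> x = \<zero>\<^bsub>M\<^esub>"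
      using x \<open>y \<in> carrier M\<close> zero add by (metis inj inj_onD)
  next
    fix x y assume "x \<in> carrier M" "y \<in> carrier M"
    then show "x \<oplus>\<^bsub>M\<^esub> y = y \<oplus>\<^bsub>M\<^esub> x"
      by (intro inj_onD[OF inj]) (simp_all add: add emb_add comm_add_vec[OF emb emb])
  qed (use zero add emb emb_zero emb_add in
      \<open>auto intro!: inj_onD[OF inj] simp: assoc_add_vec[of _ n]\<close>)
  show "module_axioms class_ring M"
    by (rule module_axioms.intro)
      (use zero add smult emb emb_zero emb_add emb_smult in
        \<open>auto intro!: inj_onD[OF inj] simp: add_smult_distrib_vec smult_add_distrib_vec[of _ n] smult_smult_assoc\<close>)
qed

text \<open>From \<pi> \<iota> = id the matrix \<open>E\<close> of \<iota> \<pi> is idempotent, so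
  \<open>R^n\<close> splits into its image, a copy of \<open>M\<close>, and its kernel. On the image
  the endomorphism acts as \<open>F\<close> and on the kernel as the identity, which is
  \<open>F E + (1 - E)\<close>.\<close>

lemma is_proj_det_retract:
  fixes M :: "('r::comm_ring_1, 'm) module"
  assumes zero: "\<zero>\<^bsub>M\<^esub> \<in> carrier M"
    and add: "\<And>x y. x \<in> carrier M \<Longrightarrow> y \<in> carrier M \<Longrightarrow> x \<oplus>\<^bsub>M\<^esub> y \<in> carrier M"
    and smult: "\<And>r x. x \<in> carrier M \<Longrightarrow> r \<odot>\<^bsub>M\<^esub> x \<in> carrier M"
    and f: "\<And>x. x \<in> carrier M \<Longrightarrow> f x \<in> carrier M"
    and emb: "\<And>x. x \<in> carrier M \<Longrightarrow> \<iota> x \<in> carrier_vec n"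
    and ret: "\<And>v. v \<in> carrier_vec n \<Longrightarrow> \<pi> v \<in> carrier M"
    and ret_emb: "\<And>x. x \<in> carrier M \<Longrightarrow> \<pi> (\<iota> x) = x"
    and emb_zero: "\<iota> \<zero>\<^bsub>M\<^esub> = 0\<^sub>v n"
    and emb_add: "\<And>x y. x \<in> carrier M \<Longrightarrow> y \<in> carrier M \<Longrightarrow> \<iota> (x \<oplus>\<^bsub>M\<^esub> y) = \<iota> x + \<iota> y"
    and emb_smult: "\<And>r x. x \<in> carrier M \<Longrightarrow> \<iota> (r \<odot>\<^bsub>M\<^esub> x) = r \<cdot>\<^sub>v \<iota> x"
    and E: "E \<in> carrier_mat n n" and F: "F \<in> carrier_mat n n"
    and emb_ret: "\<And>v. v \<in> carrier_vec n \<Longrightarrow> \<iota> (\<pi> v) = E *\<^sub>v v"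
    and emb_f: "\<And>x. x \<in> carrier M \<Longrightarrow> \<iota> (f x) = F *\<^sub>v \<iota> x"
  shows "is_proj_det M f (Determinant.det (1\<^sub>m n - E + F * E))"
proof -
  have inj: "inj_on \<iota> (carrier M)" by (rule inj_on_inverseI[of _ \<pi>]) (rule ret_emb)
  have E_emb: "E *\<^sub>v \<iota> x = \<iota> x" if "x \<in> carrier M" for x
    using that emb_ret[of "\<iota> x"] emb ret_emb by simp
  have M: "Module.module class_ring M"
  proof (rule module_if_embeds_in_vec[OF zero add smult emb inj emb_zero emb_add emb_smult])
    fix x assume x: "x \<in> carrier M"
    have "\<iota> (\<pi> (- \<iota> x)) = E *\<^sub>v (- \<iota> x)" using emb[OF x] by (intro emb_ret) auto
    also have "\<dots> = - (E *\<^sub>v \<iota> x)" using emb[OF x] E by (intro mult_mat_vec_uminus)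
    finally show "\<exists>y\<in>carrier M. \<iota> y = - \<iota> x"
      using E_emb[OF x] ret[of "- \<iota> x"] emb[OF x] by auto
  qed
  have f_hom: "f \<in> module_hom class_ring M M"
    unfolding module_hom_def
    using f add smult emb emb_add emb_smult emb_f F
    by (auto intro!: inj_onD[OF inj] simp: mult_add_distrib_mat_vec mult_mat_vec_smult[OF F])
  \<comment> \<open>The complement required by \<open>is_proj_det\<close> is the kernel of
    \<open>E\<close>, which already lives inside \<open>R^n\<close>.\<close>
  define N where "N = (module_vec TYPE('r) n)\<lparr>carrier := {v \<in> carrier_vec n. E *\<^sub>v v = 0\<^sub>v n}\<rparr>"
  have N_simps: "carrier N = {v \<in> carrier_vec n. E *\<^sub>v v = 0\<^sub>v n}" "\<zero>\<^bsub>N\<^esub> = 0\<^sub>v n"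
    "\<And>x y. x \<oplus>\<^bsub>N\<^esub> y = x + y" "\<And>r x. r \<odot>\<^bsub>N\<^esub> x = r \<cdot>\<^sub>v x"
    by (simp_all add: N_def module_vec_def)
  have N: "Module.module class_ring N"
  proof (rule module_if_embeds_in_vec[where \<iota> = "\<lambda>v. v" and n = n])
    fix x assume x: "x \<in> carrier N"
    then have "E *\<^sub>v (- x) = - (E *\<^sub>v x)" using E by (intro mult_mat_vec_uminus) (auto simp: N_simps)
    also have "\<dots> = 0\<^sub>v n" using x by (auto simp: N_simps)
    finally show "\<exists>y\<in>carrier N. y = - x" using x by (auto simp: N_simps)
  qed (use E in \<open>auto simp: N_simps mult_add_distrib_mat_vec mult_mat_vec_smult\<close>)
  define \<phi> where "\<phi> = (\<lambda>(x, y). \<iota> x + y)"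
  have \<phi>_hom: "\<phi> \<in> module_hom class_ring (direct_sum M N) (module_vec TYPE('r) n)"
  proof -
    have "\<iota> x + \<iota> x' + (y + y') = \<iota> x + y + (\<iota> x' + y')"
      if "x \<in> carrier M" "x' \<in> carrier M" "y \<in> carrier N" "y' \<in> carrier N" for x x' y y'
      using that emb[of x] emb[of x'] by (intro eq_vecI) (auto simp: N_simps)
    then show ?thesis
      using emb
      by (auto simp: module_hom_def direct_sum_def \<phi>_def module_vec_simps N_simps emb_add
          emb_smult smult_add_distrib_vec[of _ n])
  qed
  have \<phi>_bij: "bij_betw \<phi> (carrier (direct_sum M N)) (carrier_vec n)"
  proof (rule bij_betw_byWitness[where f' = "\<lambda>v. (\<pi> v, v - E *\<^sub>v v)"])
    have E_\<phi>: "E *\<^sub>v (\<iota> x + y) = \<iota> x" if "x \<in> carrier M" "y \<in> carrier N" for x y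
      using that E emb[of x] E_emb[of x] by (auto simp: N_simps mult_add_distrib_mat_vec)
    \<comment> \<open>\<pi> comes without an additivity assumption; the value is recovered from
      \<iota> \<pi> = \<open>E\<close> and injectivity of \<iota>.\<close>
    have \<pi>_\<phi>: "\<pi> (\<iota> x + y) = x" if "x \<in> carrier M" "y \<in> carrier N" for x y
      using that E_\<phi>[OF that] emb[of x] emb_ret[of "\<iota> x + y"] ret[of "\<iota> x + y"] inj_onD[OF inj, of "\<pi> (\<iota> x + y)" x]
      by (auto simp: N_simps)
    have "\<iota> x + y - \<iota> x = y" if "x \<in> carrier M" "y \<in> carrier N" for x y
      using that emb[of x] by (intro eq_vecI) (auto simp: N_simps)
    then show "\<forall>z\<in>carrier (direct_sum M N). (\<pi> (\<phi> z), \<phi> z - E *\<^sub>v \<phi> z) = z"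
      by (auto simp: direct_sum_def \<phi>_def E_\<phi> \<pi>_\<phi>)
    have "E *\<^sub>v v + (v - E *\<^sub>v v) = v" if "v \<in> carrier_vec n" for v
      using that E by (intro eq_vecI) auto
    then show "\<forall>v\<in>carrier_vec n. \<phi> (\<pi> v, v - E *\<^sub>v v) = v"
      by (simp add: \<phi>_def emb_ret)
    show "\<phi> ` carrier (direct_sum M N) \<subseteq> carrier_vec n"
      using emb by (auto simp: \<phi>_def direct_sum_def N_simps)
    have "E *\<^sub>v (v - E *\<^sub>v v) = 0\<^sub>v n" if v: "v \<in> carrier_vec n" for v
    proof -
      have "E *\<^sub>v (E *\<^sub>v v) = E *\<^sub>v v"
        using E_emb[OF ret[OF v]] emb_ret[OF v] by simp
      then show ?thesis using v E by (simp add: mult_minus_distrib_mat_vec)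
    qed
    then show "(\<lambda>v. (\<pi> v, v - E *\<^sub>v v)) ` carrier_vec n \<subseteq> carrier (direct_sum M N)"
      using ret E by (auto simp: direct_sum_def N_simps)
  qed
  have "\<phi> (f x, y) = (1\<^sub>m n - E + F * E) *\<^sub>v \<phi> (x, y)"
    if x: "x \<in> carrier M" and y: "y \<in> carrier N" for x y
  proof -
    have c: "\<iota> x \<in> carrier_vec n" "y \<in> carrier_vec n" "E *\<^sub>v y = 0\<^sub>v n"
      using emb x y by (auto simp: N_simps)
    have Ev: "E *\<^sub>v (\<iota> x + y) = \<iota> x"
      using c E E_emb[OF x] by (simp add: mult_add_distrib_mat_vec)
    have "(1\<^sub>m n - E + F * E) *\<^sub>v (\<iota> x + y) = (\<iota> x + y - \<iota> x) + F *\<^sub>v \<iota> x"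
    proof -
      let ?v = "\<iota> x + y"
      have v: "?v \<in> carrier_vec n" using c by auto
      have "(1\<^sub>m n - E + F * E) *\<^sub>v ?v = (1\<^sub>m n - E) *\<^sub>v ?v + F * E *\<^sub>v ?v"
        by (rule add_mult_distrib_mat_vec) (use E F v in auto)
      also have "F * E *\<^sub>v ?v = F *\<^sub>v (E *\<^sub>v ?v)"
        by (rule assoc_mult_mat_vec) (use E F v in auto)
      also have "(1\<^sub>m n - E) *\<^sub>v ?v = 1\<^sub>m n *\<^sub>v ?v - E *\<^sub>v ?v"
        by (rule minus_mult_distrib_mat_vec) (use E v in auto)
      finally show ?thesis using v Ev by simp
    qed
    also have "\<dots> = F *\<^sub>v \<iota> x + y" using c F by (intro eq_vecI) auto
    finally show ?thesis by (simp add: \<phi>_def emb_f x)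
  qed
  then show ?thesis
    unfolding is_proj_det_def using M f_hom N \<phi>_hom \<phi>_bij E F
    by (intro conjI exI[of _ N] exI[of _ n] exI[of _ \<phi>] exI[of _ "1\<^sub>m n - E + F * E"]) auto
qed

text \<open>Hides the complement: \<iota> is \<phi> on the first summand, \<pi> the first component
  of the inverse of \<phi>, and the matrix becomes \<open>A = 1 + \<iota> (f - 1) \<pi>\<close>. In
  this form two presentations of \<open>M\<close> can be compared although their complements are
  unrelated.\<close>

lemma is_proj_detE:
  fixes M :: "('r::comm_ring_1, 'm) module"
  assumes "is_proj_det M f d"
  obtains n A \<iota> \<pi> where "A \<in> carrier_mat n n" "d = Determinant.det A"
    "\<And>x. x \<in> carrier M \<Longrightarrow> \<iota> x \<in> carrier_vec n"
    "\<And>v. v \<in> carrier_vec n \<Longrightarrow> \<pi> v \<in> carrier M"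
    "\<And>x. x \<in> carrier M \<Longrightarrow> \<pi> (\<iota> x) = x"
    "\<And>x y. x \<in> carrier M \<Longrightarrow> y \<in> carrier M \<Longrightarrow> \<iota> (x \<oplus>\<^bsub>M\<^esub> y) = \<iota> x + \<iota> y"
    "\<And>r x. x \<in> carrier M \<Longrightarrow> \<iota> (r \<odot>\<^bsub>M\<^esub> x) = r \<cdot>\<^sub>v \<iota> x"
    "\<And>v w. v \<in> carrier_vec n \<Longrightarrow> w \<in> carrier_vec n \<Longrightarrow> \<pi> (v + w) = \<pi> v \<oplus>\<^bsub>M\<^esub> \<pi> w"
    "\<And>r v. v \<in> carrier_vec n \<Longrightarrow> \<pi> (r \<cdot>\<^sub>v v) = r \<odot>\<^bsub>M\<^esub> \<pi> v"
    "\<And>v. v \<in> carrier_vec n \<Longrightarrow> A *\<^sub>v v = v + (\<iota> (f (\<pi> v)) - \<iota> (\<pi> v))"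
proof -
  obtain N :: "('r, 'r vec) module" and n \<phi> A where
    M: "Module.module class_ring M" and f: "f \<in> module_hom class_ring M M" and
    N: "Module.module class_ring N" and
    \<phi>: "\<phi> \<in> module_hom class_ring (direct_sum M N) (module_vec TYPE('r) n)" and
    bij: "bij_betw \<phi> (carrier (direct_sum M N)) (carrier_vec n)" and
    A: "A \<in> carrier_mat n n" "\<And>x y. x \<in> carrier M \<Longrightarrow> y \<in> carrier N \<Longrightarrow> \<phi> (f x, y) = A *\<^sub>v \<phi> (x, y)" and
    d: "d = Determinant.det A"
    using assms unfolding is_proj_det_def by blast
  interpret M: Module.module class_ring M by (rule M)
  interpret N: Module.module class_ring N by (rule N)
  have f_closed: "f x \<in> carrier M" if "x \<in> carrier M" for x
    using module_hom_closed[OF f] that by auto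
  have \<phi>_closed: "\<phi> (x, y) \<in> carrier_vec n" if "x \<in> carrier M" "y \<in> carrier N" for x y
    using module_hom_closed[OF \<phi>] that by (auto simp: direct_sum_def module_vec_simps)
  have \<phi>_add: "\<phi> (x \<oplus>\<^bsub>M\<^esub> x', y \<oplus>\<^bsub>N\<^esub> y') = \<phi> (x, y) + \<phi> (x', y')"
    if "x \<in> carrier M" "y \<in> carrier N" "x' \<in> carrier M" "y' \<in> carrier N" for x y x' y'
    using module_hom_add[OF \<phi>, of "(x, y)" "(x', y')"] that by (auto simp: direct_sum_def module_vec_simps)
  have \<phi>_smult: "\<phi> (r \<odot>\<^bsub>M\<^esub> x, r \<odot>\<^bsub>N\<^esub> y) = r \<cdot>\<^sub>v \<phi> (x, y)"
    if "x \<in> carrier M" "y \<in> carrier N" for r x y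
    using module_hom_smult[OF \<phi>, of r "(x, y)"] that by (auto simp: direct_sum_def module_vec_simps)
  define \<pi> where "\<pi> v = fst (the_inv_into (carrier (direct_sum M N)) \<phi> v)" for v
  define \<iota> where "\<iota> x = \<phi> (x, \<zero>\<^bsub>N\<^esub>)" for x
  have \<pi>_\<phi>: "\<pi> (\<phi> (x, y)) = x" if "x \<in> carrier M" "y \<in> carrier N" for x y
    unfolding \<pi>_def using that bij
    by (subst the_inv_into_f_f) (auto simp: bij_betw_def direct_sum_def)
  have decomp: "\<exists>x\<in>carrier M. \<exists>y\<in>carrier N. v = \<phi> (x, y)" if "v \<in> carrier_vec n" for v
  proof -
    have "v \<in> \<phi> ` (carrier M \<times> carrier N)"
      using bij that by (simp add: bij_betw_def direct_sum_def)
    then show ?thesis by auto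
  qed
  have r0: "r \<odot>\<^bsub>N\<^esub> \<zero>\<^bsub>N\<^esub> = \<zero>\<^bsub>N\<^esub>" for r
    using N.smult_r_null[of r] by simp
  show thesis
  proof (rule that[of A n \<iota> \<pi>])
    show "\<iota> (x \<oplus>\<^bsub>M\<^esub> y) = \<iota> x + \<iota> y" if "x \<in> carrier M" "y \<in> carrier M" for x y
      using \<phi>_add[of x "\<zero>\<^bsub>N\<^esub>" y "\<zero>\<^bsub>N\<^esub>"] that by (simp add: \<iota>_def)
    show "\<iota> (r \<odot>\<^bsub>M\<^esub> x) = r \<cdot>\<^sub>v \<iota> x" if "x \<in> carrier M" for r x
      using \<phi>_smult[of x "\<zero>\<^bsub>N\<^esub>" r] that by (simp add: \<iota>_def r0)
    show "\<pi> (v + w) = \<pi> v \<oplus>\<^bsub>M\<^esub> \<pi> w" if v: "v \<in> carrier_vec n" and w: "w \<in> carrier_vec n" for v w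
      using decomp[OF v] decomp[OF w] by (auto simp: \<phi>_add[symmetric] \<pi>_\<phi>)
    show "\<pi> (r \<cdot>\<^sub>v v) = r \<odot>\<^bsub>M\<^esub> \<pi> v" if v: "v \<in> carrier_vec n" for r v
      using decomp[OF v] by (auto simp: \<phi>_smult[symmetric] \<pi>_\<phi>)
    show "A *\<^sub>v v = v + (\<iota> (f (\<pi> v)) - \<iota> (\<pi> v))" if v: "v \<in> carrier_vec n" for v
    proof -
      obtain x y where x: "x \<in> carrier M" and y: "y \<in> carrier N" and v: "v = \<phi> (x, y)"
        using decomp[OF v] by blast
      have split: "\<phi> (x, y) = \<iota> x + \<phi> (\<zero>\<^bsub>M\<^esub>, y)" if "x \<in> carrier M" for x
        using \<phi>_add[of x "\<zero>\<^bsub>N\<^esub>" "\<zero>\<^bsub>M\<^esub>" y] that y by (simp add: \<iota>_def)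
      have "A *\<^sub>v v = \<iota> (f x) + \<phi> (\<zero>\<^bsub>M\<^esub>, y)"
        using A(2)[OF x y] split[OF f_closed[OF x]] v by simp
      also have "\<dots> = \<iota> x + \<phi> (\<zero>\<^bsub>M\<^esub>, y) + (\<iota> (f x) - \<iota> x)"
        using \<phi>_closed[OF x N.zero_closed] \<phi>_closed[OF f_closed[OF x] N.zero_closed]
          \<phi>_closed[OF M.zero_closed y]
        by (intro eq_vecI) (auto simp: \<iota>_def)
      finally show ?thesis using split[OF x] v \<pi>_\<phi>[OF x y] by simp
    qed
    show "\<pi> v \<in> carrier M" if v: "v \<in> carrier_vec n" for v
      using decomp[OF v] \<pi>_\<phi> by auto
  qed (use A d \<phi>_closed \<pi>_\<phi> in \<open>auto simp: \<iota>_def\<close>)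
qed

text \<open>If \<open>(\<iota>, \<pi>)\<close> and \<open>(\<iota>', \<pi>')\<close> exhibit \<open>M\<close> as a summand of two free modules, then with \<open>S = \<iota>' \<pi>\<close>,
  \<open>T = \<iota> \<pi>'\<close> and \<open>B = A - 1\<close> one has \<open>A' = 1 + S (B T)\<close> and \<open>A = 1 + (B T) S\<close>.\<close>

lemma is_proj_det_unique:
  fixes M :: "('r::comm_ring_1, 'm) module"
  assumes d: "is_proj_det M f d" and d': "is_proj_det M f d'"
  shows "d = d'"
proof -
  from d obtain n A \<iota> \<pi> where A: "A \<in> carrier_mat n n" "d = Determinant.det A"
    and \<iota>: "\<And>x. x \<in> carrier M \<Longrightarrow> \<iota> x \<in> carrier_vec n"
    and \<pi>: "\<And>v. v \<in> carrier_vec n \<Longrightarrow> \<pi> v \<in> carrier M"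
    and \<pi>_\<iota>: "\<And>x. x \<in> carrier M \<Longrightarrow> \<pi> (\<iota> x) = x"
    and \<iota>_lin: "\<And>x y. x \<in> carrier M \<Longrightarrow> y \<in> carrier M \<Longrightarrow> \<iota> (x \<oplus>\<^bsub>M\<^esub> y) = \<iota> x + \<iota> y"
      "\<And>r x. x \<in> carrier M \<Longrightarrow> \<iota> (r \<odot>\<^bsub>M\<^esub> x) = r \<cdot>\<^sub>v \<iota> x"
    and \<pi>_lin: "\<And>v w. v \<in> carrier_vec n \<Longrightarrow> w \<in> carrier_vec n \<Longrightarrow> \<pi> (v + w) = \<pi> v \<oplus>\<^bsub>M\<^esub> \<pi> w"
      "\<And>r v. v \<in> carrier_vec n \<Longrightarrow> \<pi> (r \<cdot>\<^sub>v v) = r \<odot>\<^bsub>M\<^esub> \<pi> v"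
    and Av: "\<And>v. v \<in> carrier_vec n \<Longrightarrow> A *\<^sub>v v = v + (\<iota> (f (\<pi> v)) - \<iota> (\<pi> v))"
    by (rule is_proj_detE) blast
  from d' obtain m A' \<iota>' \<pi>' where A': "A' \<in> carrier_mat m m" "d' = Determinant.det A'"
    and \<iota>': "\<And>x. x \<in> carrier M \<Longrightarrow> \<iota>' x \<in> carrier_vec m"
    and \<pi>': "\<And>v. v \<in> carrier_vec m \<Longrightarrow> \<pi>' v \<in> carrier M"
    and \<pi>_\<iota>': "\<And>x. x \<in> carrier M \<Longrightarrow> \<pi>' (\<iota>' x) = x"
    and \<iota>_lin': "\<And>x y. x \<in> carrier M \<Longrightarrow> y \<in> carrier M \<Longrightarrow> \<iota>' (x \<oplus>\<^bsub>M\<^esub> y) = \<iota>' x + \<iota>' y"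
      "\<And>r x. x \<in> carrier M \<Longrightarrow> \<iota>' (r \<odot>\<^bsub>M\<^esub> x) = r \<cdot>\<^sub>v \<iota>' x"
    and \<pi>_lin': "\<And>v w. v \<in> carrier_vec m \<Longrightarrow> w \<in> carrier_vec m \<Longrightarrow> \<pi>' (v + w) = \<pi>' v \<oplus>\<^bsub>M\<^esub> \<pi>' w"
      "\<And>r v. v \<in> carrier_vec m \<Longrightarrow> \<pi>' (r \<cdot>\<^sub>v v) = r \<odot>\<^bsub>M\<^esub> \<pi>' v"
    and Av': "\<And>v. v \<in> carrier_vec m \<Longrightarrow> A' *\<^sub>v v = v + (\<iota>' (f (\<pi>' v)) - \<iota>' (\<pi>' v))"
    by (rule is_proj_detE) blast
  have f: "f x \<in> carrier M" if "x \<in> carrier M" for x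
    using d that unfolding is_proj_det_def module_hom_def by blast
  obtain S where S: "S \<in> carrier_mat m n" and Sv: "\<And>v. v \<in> carrier_vec n \<Longrightarrow> S *\<^sub>v v = \<iota>' (\<pi> v)"
    by (rule linear_vec_map_eq_mat[of "\<lambda>v. \<iota>' (\<pi> v)" n m])
      (auto simp: \<iota>' \<pi> \<iota>_lin' \<pi>_lin)
  obtain T where T: "T \<in> carrier_mat n m" and Tv: "\<And>v. v \<in> carrier_vec m \<Longrightarrow> T *\<^sub>v v = \<iota> (\<pi>' v)"
    by (rule linear_vec_map_eq_mat[of "\<lambda>v. \<iota> (\<pi>' v)" m n])
      (auto simp: \<iota> \<pi>' \<iota>_lin \<pi>_lin')
  define B where "B = A - 1\<^sub>m n"
  have B: "B \<in> carrier_mat n n" using A by (simp add: B_def minus_carrier_mat)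
  have Bv: "B *\<^sub>v v = \<iota> (f (\<pi> v)) - \<iota> (\<pi> v)" if v: "v \<in> carrier_vec n" for v
  proof -
    have c: "\<iota> (f (\<pi> v)) \<in> carrier_vec n" "\<iota> (\<pi> v) \<in> carrier_vec n" using \<iota> \<pi> f v by auto
    have "B *\<^sub>v v = A *\<^sub>v v - v"
      using A v by (simp add: B_def minus_mult_distrib_mat_vec[of _ n n])
    also have "\<dots> = \<iota> (f (\<pi> v)) - \<iota> (\<pi> v)"
      unfolding Av[OF v] using v c by (intro eq_vecI) auto
    finally show ?thesis .
  qed
  have eqI: "P = Q" if "P \<in> carrier_mat k k" "Q \<in> carrier_mat k k"
    "\<And>v. v \<in> carrier_vec k \<Longrightarrow> P *\<^sub>v v = Q *\<^sub>v v" for P Q :: "'r mat" and k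
  proof (rule eq_matI)
    fix i j assume "i < dim_row Q" "j < dim_col Q"
    then show "P $$ (i, j) = Q $$ (i, j)"
      using that(1,2) arg_cong[OF that(3)[of "unit_vec k j"], of "\<lambda>v. v $ i"]
      by (auto simp: scalar_prod_right_unit)
  qed (use that in auto)
  have "1\<^sub>m m + S * (B * T) = A'"
  proof (rule eqI)
    fix v :: "'r vec" assume v: "v \<in> carrier_vec m"
    have Tv_c: "T *\<^sub>v v \<in> carrier_vec n" using T v by auto
    have c: "\<iota> (f (\<pi>' v)) \<in> carrier_vec n" "\<iota> (\<pi>' v) \<in> carrier_vec n" using \<iota> \<pi>' f v by auto
    have "(1\<^sub>m m + S * (B * T)) *\<^sub>v v = v + S *\<^sub>v (B *\<^sub>v (T *\<^sub>v v))"
      using S B T v by (simp add: add_mult_distrib_mat_vec[of _ m m] assoc_mult_mat_vec[of S m n "B * T" m]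
          assoc_mult_mat_vec[of B n n T m])
    also have "B *\<^sub>v (T *\<^sub>v v) = \<iota> (f (\<pi>' v)) - \<iota> (\<pi>' v)"
      using Bv[OF Tv_c] by (simp add: Tv v \<pi>_\<iota> \<pi>')
    also have "S *\<^sub>v \<dots> = \<iota>' (f (\<pi>' v)) - \<iota>' (\<pi>' v)"
      using c S by (subst mult_minus_distrib_mat_vec[OF S]) (simp_all add: Sv \<pi>_\<iota> \<pi>' f v)
    finally show "(1\<^sub>m m + S * (B * T)) *\<^sub>v v = A' *\<^sub>v v" by (simp add: Av' v)
  qed (use S B T A' in auto)
  moreover have "1\<^sub>m n + (B * T) * S = A"
  proof (rule eqI)
    fix v :: "'r vec" assume v: "v \<in> carrier_vec n"
    have Sv_c: "S *\<^sub>v v \<in> carrier_vec m" using S v by auto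
    have TSv: "T *\<^sub>v (S *\<^sub>v v) = \<iota> (\<pi> v)"
      using Tv[OF Sv_c] by (simp add: Sv v \<pi>_\<iota>' \<pi>)
    have "(B * T) * S *\<^sub>v v = (B * T) *\<^sub>v (S *\<^sub>v v)"
      by (rule assoc_mult_mat_vec) (use S B T v in auto)
    also have "\<dots> = B *\<^sub>v (T *\<^sub>v (S *\<^sub>v v))"
      by (rule assoc_mult_mat_vec) (use B T Sv_c in auto)
    finally have "(1\<^sub>m n + (B * T) * S) *\<^sub>v v = v + B *\<^sub>v (T *\<^sub>v (S *\<^sub>v v))"
      using S B T v by (subst add_mult_distrib_mat_vec[of _ n n]) auto
    also have "B *\<^sub>v (T *\<^sub>v (S *\<^sub>v v)) = \<iota> (f (\<pi> v)) - \<iota> (\<pi> v)"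
      unfolding TSv using Bv[of "\<iota> (\<pi> v)"] by (simp add: \<iota> \<pi> v \<pi>_\<iota>)
    finally show "(1\<^sub>m n + (B * T) * S) *\<^sub>v v = A *\<^sub>v v" by (simp add: Av v)
  qed (use S B T A in auto)
  \<comment> \<open>The ranks \<open>n\<close> and \<open>m\<close> may differ, so the identity is
    applied to the rectangular factors \<open>S\<close> and \<open>B * T\<close>.\<close>
  ultimately show ?thesis
    using det_one_add_mult_commute[of S m n "B * T"] S B T A(2) A'(2) by simp
qed

corollary proj_det_eqI: "is_proj_det M f d \<Longrightarrow> proj_det M f = d"
  unfolding proj_det_def using is_proj_det_unique by blast

section \<open>Vertex chains as a summand of a free module\<close>

lemma lookup_mult_finite:
  fixes r s :: "'g::{finite, ab_group_add} \<Rightarrow>\<^sub>0 'a::semiring_0"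
  shows "Poly_Mapping.lookup (r * s) h = (\<Sum>g\<in>UNIV. Poly_Mapping.lookup r g * Poly_Mapping.lookup s (h - g))"
proof -
  have "(\<Sum>q. Poly_Mapping.lookup s q when h = l + q) = Poly_Mapping.lookup s (h - l)" for l
  proof -
    have "(\<Sum>q. Poly_Mapping.lookup s q when h = l + q) = (\<Sum>q. Poly_Mapping.lookup s q when q = h - l)"
      by (rule Sum_any.cong) (auto simp: when_def algebra_simps)
    then show ?thesis by simp
  qed
  then show ?thesis
    by (simp add: lookup_mult Sum_any.expand_superset[of UNIV])
qed

lemma char_ext_eq_sum_UNIV:
  fixes \<psi> :: "'g::finite \<Rightarrow> complex"
  shows "char_ext \<psi> r = (\<Sum>g\<in>UNIV. Poly_Mapping.lookup r g * \<psi> g)"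
  unfolding char_ext_def
  by (rule sum.mono_neutral_left) (auto simp: in_keys_iff)

lemma character_zero:
  assumes "is_character \<psi>"
  shows "\<psi> 0 = 1"
proof -
  have "\<psi> (0 + 0) = \<psi> 0 * \<psi> 0" "\<psi> 0 \<noteq> 0"
    using assms unfolding is_character_def by blast+
  then show ?thesis by simp
qed

lemma char_ext_single: "char_ext \<psi> (Poly_Mapping.single g c) = c * \<psi> g"
  by (simp add: char_ext_def)

text \<open>The shift \<open>h \<mapsto> g + h\<close> turns convolution into a product of two sums.
  Being a ring homomorphism is what lets a character pass through the determinant.\<close>

lemma comm_ring_hom_char_ext:
  fixes \<psi> :: "'g::{finite, ab_group_add} \<Rightarrow> complex"
  assumes \<psi>: "is_character \<psi>"
  shows "comm_ring_hom (char_ext \<psi>)"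
proof
  show "char_ext \<psi> 0 = 0" by (simp add: char_ext_def)
  show "char_ext \<psi> 1 = 1" using character_zero[OF \<psi>] by (simp add: char_ext_def)
  show "char_ext \<psi> (r + s) = char_ext \<psi> r + char_ext \<psi> s" for r s
    by (simp add: char_ext_eq_sum_UNIV lookup_add algebra_simps sum.distrib)
  show "char_ext \<psi> (r * s) = char_ext \<psi> r * char_ext \<psi> s" for r s
  proof -
    have "char_ext \<psi> (r * s) = (\<Sum>g\<in>UNIV. \<Sum>h\<in>UNIV. Poly_Mapping.lookup r g * Poly_Mapping.lookup s (h - g) * \<psi> h)"
      by (simp add: char_ext_eq_sum_UNIV lookup_mult_finite sum_distrib_right) (rule sum.swap)
    also have "\<dots> = (\<Sum>g\<in>UNIV. \<Sum>h\<in>UNIV. Poly_Mapping.lookup r g * Poly_Mapping.lookup s h * \<psi> (g + h))"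
    proof (rule sum.cong[OF refl])
      show "(\<Sum>h\<in>UNIV. Poly_Mapping.lookup r g * Poly_Mapping.lookup s (h - g) * \<psi> h)
          = (\<Sum>h\<in>UNIV. Poly_Mapping.lookup r g * Poly_Mapping.lookup s h * \<psi> (g + h))" for g
        by (rule sum.reindex_bij_witness[of _ "\<lambda>h. g + h" "\<lambda>h. h - g"]) auto
    qed
    also have "\<dots> = char_ext \<psi> r * char_ext \<psi> s"
      using \<psi> by (simp add: char_ext_eq_sum_UNIV sum_product is_character_def mult_ac)
    finally show ?thesis .
  qed
qed

lemma lookup_lin_ext:
  "Poly_Mapping.lookup (lin_ext T x) u = (\<Sum>w\<in>Poly_Mapping.keys x. Poly_Mapping.lookup x w * Poly_Mapping.lookup (T w) u)"
proof -
  have "Poly_Mapping.lookup (Poly_Mapping.map ((*) c) q) u = c * Poly_Mapping.lookup q u" for c and q :: "'a \<Rightarrow>\<^sub>0 complex"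
    by (simp add: Poly_Mapping.map.rep_eq when_def)
  then show ?thesis by (simp add: lin_ext_def lookup_sum)
qed

text \<open>The list \<open>vs\<close> fixes an order of the vertices, so that matrices and vectors,
  which are indexed by numbers, can describe operators on chains.\<close>

locale finite_graph_action = fin_digraph Y + graph_action Y bar actV actE
  for Y :: "('v, 'e) pre_digraph" and bar :: "'e \<Rightarrow> 'e"
    and actV :: "'g::{finite, ab_group_add} \<Rightarrow> 'v \<Rightarrow> 'v"
    and actE :: "'g \<Rightarrow> 'e \<Rightarrow> 'e" +
  fixes vs :: "'v list"
  assumes distinct_vs: "distinct vs" and set_vs: "set vs = verts Y"
begin

lemma actV_cancel: "w \<in> verts Y \<Longrightarrow> actV g (actV (- g) w) = w"
  and actV_cancel': "w \<in> verts Y \<Longrightarrow> actV (- g) (actV g w) = w"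
  using actV_add[of w g "- g"] actV_add[of w "- g" g] actV_zero by auto

lemma actV_eq_iff:
  assumes "v \<in> verts Y" "w \<in> verts Y"
  shows "actV g v = actV h w \<longleftrightarrow> v = actV (h - g) w"
proof
  assume "actV g v = actV h w"
  then have "actV (- g) (actV g v) = actV (- g) (actV h w)" by simp
  then show "v = actV (h - g) w"
    using assms actV_cancel' actV_add[of w "- g" h] by simp
next
  assume "v = actV (h - g) w"
  then show "actV g v = actV h w"
    using assms actV_add[of w g "h - g"] by simp
qed

lemma vs_in_verts: "m < length vs \<Longrightarrow> vs ! m \<in> verts Y"
  using set_vs nth_mem by blast

lemma sum_vs: "(\<Sum>m<length vs. f (vs ! m)) = (\<Sum>w\<in>verts Y. f w)"
  using sum.reindex_bij_betw[OF bij_betw_nth[OF distinct_vs refl refl], of f] set_vs by simp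

lemma lookup_eq_0: "Poly_Mapping.keys x \<subseteq> verts Y \<Longrightarrow> w \<notin> verts Y \<Longrightarrow> Poly_Mapping.lookup x w = 0"
  by (meson in_keys_iff subsetD)

lemma lookup_grp_alg_scale:
  assumes x: "Poly_Mapping.keys x \<subseteq> verts Y" and w: "w \<in> verts Y"
  shows "Poly_Mapping.lookup (grp_alg_scale actV r x) w = (\<Sum>g\<in>UNIV. Poly_Mapping.lookup r g * Poly_Mapping.lookup x (actV (- g) w))"
proof -
  have "(\<Sum>v\<in>Poly_Mapping.keys x. Poly_Mapping.lookup (Poly_Mapping.single (actV g v) (Poly_Mapping.lookup r g * Poly_Mapping.lookup x v)) w)
      = Poly_Mapping.lookup r g * Poly_Mapping.lookup x (actV (- g) w)" for g
  proof -
    have "(\<Sum>v\<in>Poly_Mapping.keys x. Poly_Mapping.lookup (Poly_Mapping.single (actV g v) (Poly_Mapping.lookup r g * Poly_Mapping.lookup x v)) w)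
      = (\<Sum>v\<in>Poly_Mapping.keys x. if v = actV (- g) w then Poly_Mapping.lookup r g * Poly_Mapping.lookup x v else 0)"
      using x w actV_eq_iff[of _ w g 0] actV_zero[OF w]
      by (intro sum.cong refl) (auto simp: lookup_single when_def)
    also have "\<dots> = Poly_Mapping.lookup r g * Poly_Mapping.lookup x (actV (- g) w)"
      by (simp add: sum.delta) (auto simp: in_keys_iff)
    finally show ?thesis .
  qed
  then have "Poly_Mapping.lookup (grp_alg_scale actV r x) w = (\<Sum>g\<in>Poly_Mapping.keys r. Poly_Mapping.lookup r g * Poly_Mapping.lookup x (actV (- g) w))"
    by (simp add: grp_alg_scale_def lookup_sum)
  also have "\<dots> = (\<Sum>g\<in>UNIV. Poly_Mapping.lookup r g * Poly_Mapping.lookup x (actV (- g) w))"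
    by (rule sum.mono_neutral_left) (auto simp: in_keys_iff)
  finally show ?thesis .
qed

lemma keys_sum_subset: "(\<And>i. i \<in> I \<Longrightarrow> Poly_Mapping.keys (f i) \<subseteq> A) \<Longrightarrow> Poly_Mapping.keys (sum f I) \<subseteq> A"
  using keys_sum[of f I] by blast

lemma keys_grp_alg_scale: "Poly_Mapping.keys x \<subseteq> verts Y \<Longrightarrow> Poly_Mapping.keys (grp_alg_scale actV r x) \<subseteq> verts Y"
  unfolding grp_alg_scale_def using actV_closed
  by (intro keys_sum_subset) (auto split: if_splits)

text \<open>The coordinate at \<open>w\<close> of \<open>|G|\<^sup>-\<^sup>1 \<Sum>\<^sub>g g\<^sup>-\<^sup>1 \<otimes> g x\<close>.\<close>

definition orbit_fun :: "'v \<Rightarrow> ('v \<Rightarrow>\<^sub>0 complex) \<Rightarrow> ('g \<Rightarrow>\<^sub>0 complex)" where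
  "orbit_fun w x = Abs_poly_mapping (\<lambda>g. Poly_Mapping.lookup x (actV g w) / of_nat (card (UNIV :: 'g set)))"

lemma lookup_orbit_fun [simp]: "Poly_Mapping.lookup (orbit_fun w x) g = Poly_Mapping.lookup x (actV g w) / of_nat (card (UNIV :: 'g set))"
  by (simp add: orbit_fun_def)

lemma orbit_fun_zero [simp]: "orbit_fun w 0 = 0"
  and orbit_fun_add: "orbit_fun w (x + y) = orbit_fun w x + orbit_fun w y"
  and orbit_fun_diff: "orbit_fun w (x - y) = orbit_fun w x - orbit_fun w y"
  by (auto intro!: poly_mapping_eqI simp: lookup_add lookup_minus add_divide_distrib diff_divide_distrib)

lemma orbit_fun_sum: "orbit_fun w (sum f I) = (\<Sum>i\<in>I. orbit_fun w (f i))"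
  by (rule poly_mapping_eqI) (simp add: lookup_sum sum_divide_distrib)

text \<open>Since \<open>- g\<close> applied to \<open>h w\<close> is \<open>(h - g) w\<close>, the
  coefficients of the scaled chain along the orbit of \<open>w\<close> form a convolution. So the
  averaging map is linear over the group algebra, not only over the complex numbers.\<close>

lemma orbit_fun_grp_alg_scale:
  assumes "Poly_Mapping.keys x \<subseteq> verts Y" "w \<in> verts Y"
  shows "orbit_fun w (grp_alg_scale actV r x) = r * orbit_fun w x"
proof (rule poly_mapping_eqI)
  fix h
  have "actV (- g) (actV h w) = actV (h - g) w" for g
    using actV_add[OF assms(2), of "- g" h] by simp
  then show "Poly_Mapping.lookup (orbit_fun w (grp_alg_scale actV r x)) h = Poly_Mapping.lookup (r * orbit_fun w x) h"
    using assms by (simp add: lookup_grp_alg_scale actV_closed lookup_mult_finite sum_divide_distrib)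
qed

text \<open>The chain \<open>r w\<close>: the map from the group algebra to \<open>C_0(Y)\<close>
  that sends 1 to the vertex \<open>w\<close>.\<close>

definition push :: "'v \<Rightarrow> ('g \<Rightarrow>\<^sub>0 complex) \<Rightarrow> ('v \<Rightarrow>\<^sub>0 complex)" where
  "push w r = (\<Sum>g\<in>UNIV. Poly_Mapping.single (actV g w) (Poly_Mapping.lookup r g))"

lemma lookup_push: "Poly_Mapping.lookup (push w r) u = (\<Sum>g\<in>UNIV. if actV g w = u then Poly_Mapping.lookup r g else 0)"
  by (simp add: push_def lookup_sum lookup_single when_def)

lemma push_zero [simp]: "push w 0 = 0"
  by (simp add: push_def)

lemma keys_push: "w \<in> verts Y \<Longrightarrow> Poly_Mapping.keys (push w r) \<subseteq> verts Y"
  unfolding push_def using actV_closed by (intro keys_sum_subset) (auto split: if_splits)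

text \<open>Each group element moves exactly one vertex to \<open>u\<close>, so \<open>u\<close>
  receives its own coefficient divided by the group order, once for every group element.\<close>

lemma sum_push_orbit_fun:
  assumes x: "Poly_Mapping.keys x \<subseteq> verts Y"
  shows "(\<Sum>w\<in>verts Y. push w (orbit_fun w x)) = x"
proof (rule poly_mapping_eqI)
  fix u
  show "Poly_Mapping.lookup (\<Sum>w\<in>verts Y. push w (orbit_fun w x)) u = Poly_Mapping.lookup x u"
  proof (cases "u \<in> verts Y")
    case True
    have "Poly_Mapping.lookup (\<Sum>w\<in>verts Y. push w (orbit_fun w x)) u
        = (\<Sum>w\<in>verts Y. \<Sum>g\<in>UNIV. if actV g w = u then Poly_Mapping.lookup x u / of_nat (card (UNIV :: 'g set)) else 0)"
      by (auto simp: lookup_sum lookup_push intro!: sum.cong)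
    also have "\<dots> = (\<Sum>g\<in>UNIV. \<Sum>w\<in>verts Y. if actV g w = u then Poly_Mapping.lookup x u / of_nat (card (UNIV :: 'g set)) else 0)"
      by (rule sum.swap)
    also have "\<dots> = (\<Sum>g\<in>(UNIV :: 'g set). \<Sum>w\<in>verts Y. if w = actV (- g) u then Poly_Mapping.lookup x u / of_nat (card (UNIV :: 'g set)) else 0)"
      using actV_eq_iff[OF _ True, of _ _ 0] actV_zero[OF True] by (auto intro!: sum.cong)
    also have "\<dots> = Poly_Mapping.lookup x u"
      using True actV_closed by simp
    finally show ?thesis .
  next
    case False
    then have "Poly_Mapping.lookup (push w r) u = 0" if "w \<in> verts Y" for w r
      using keys_push[OF that] lookup_eq_0 by blast
    then show ?thesis using False x by (simp add: lookup_sum lookup_eq_0)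
  qed
qed

definition emb :: "('v \<Rightarrow>\<^sub>0 complex) poly \<Rightarrow> ('g \<Rightarrow>\<^sub>0 complex) poly vec" where
  "emb x = vec (length vs) (\<lambda>m. map_poly (orbit_fun (vs ! m)) x)"

definition ret :: "('g \<Rightarrow>\<^sub>0 complex) poly vec \<Rightarrow> ('v \<Rightarrow>\<^sub>0 complex) poly" where
  "ret v = (\<Sum>m<length vs. map_poly (push (vs ! m)) (v $ m))"

text \<open>The matrix of \<open>emb\<close> after \<open>ret\<close>; column \<open>l\<close> is
  the embedded vertex \<open>vs ! l\<close>. Its entries are constant in \<open>u\<close> because
  averaging acts on coefficients only.\<close>

definition idem :: "('g \<Rightarrow>\<^sub>0 complex) poly mat" where
  "idem = mat (length vs) (length vs) (\<lambda>(m, l). [:orbit_fun (vs ! m) (Poly_Mapping.single (vs ! l) 1):])"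

lemma carrier_C0_poly: "carrier (C0_poly Y actV) = {p. \<forall>i. Poly_Mapping.keys (Polynomial.coeff p i) \<subseteq> verts Y}"
  by (simp add: C0_poly_def)

text \<open>The Cauchy product: the degree bounds in the definition cut off only terms that
  vanish.\<close>

lemma coeff_C0_smult:
  "Polynomial.coeff (r \<odot>\<^bsub>C0_poly Y actV\<^esub> x) k
    = (\<Sum>i\<le>k. grp_alg_scale actV (Polynomial.coeff r i) (Polynomial.coeff x (k - i)))"
proof -
  let ?s = "\<lambda>i j. grp_alg_scale actV (Polynomial.coeff r i) (Polynomial.coeff x j)"
  have s0: "?s i j = 0" if "degree r < i \<or> degree x < j" for i j
    using that by (auto simp: coeff_eq_0 grp_alg_scale_def)
  have "Polynomial.coeff (r \<odot>\<^bsub>C0_poly Y actV\<^esub> x) k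
      = (\<Sum>i\<le>degree r. \<Sum>j\<le>degree x. if i + j = k then ?s i j else 0)"
    by (simp add: C0_poly_def coeff_sum coeff_monom)
  also have "\<dots> = (\<Sum>i\<le>degree r. if i \<le> k then ?s i (k - i) else 0)"
  proof (rule sum.cong[OF refl])
    fix i
    have "(\<Sum>j\<le>degree x. if i + j = k then ?s i j else 0)
        = (\<Sum>j\<le>degree x. if j = k - i then (if i \<le> k then ?s i (k - i) else 0) else 0)"
      by (rule sum.cong) auto
    also have "\<dots> = (if i \<le> k then ?s i (k - i) else 0)"
      using s0[of i "k - i"] by (auto simp: sum.delta)
    finally show "(\<Sum>j\<le>degree x. if i + j = k then ?s i j else 0)
        = (if i \<le> k then ?s i (k - i) else 0)" .
  qed
  \<comment> \<open>A common range for the bounds \<open>degree r\<close> and \<open>k\<close>,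
    whichever is larger; the added terms are zero.\<close>
  also have "\<dots> = (\<Sum>i\<le>max k (degree r). if i \<le> k then ?s i (k - i) else 0)"
    by (rule sum.mono_neutral_left) (auto simp: s0)
  also have "\<dots> = (\<Sum>i\<le>k. ?s i (k - i))"
    by (rule sum.mono_neutral_cong_right) auto
  finally show ?thesis .
qed

lemma emb_smult:
  assumes x: "x \<in> carrier (C0_poly Y actV)"
  shows "emb (r \<odot>\<^bsub>C0_poly Y actV\<^esub> x) = r \<cdot>\<^sub>v emb x"
proof (rule eq_vecI)
  fix m assume "m < dim_vec (r \<cdot>\<^sub>v emb x)"
  then have m: "m < length vs" by (simp add: emb_def)
  show "emb (r \<odot>\<^bsub>C0_poly Y actV\<^esub> x) $ m = (r \<cdot>\<^sub>v emb x) $ m"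
  proof (rule poly_eqI)
    fix k
    have "Poly_Mapping.keys (Polynomial.coeff x i) \<subseteq> verts Y" for i using x by (simp add: carrier_C0_poly)
    then show "Polynomial.coeff (emb (r \<odot>\<^bsub>C0_poly Y actV\<^esub> x) $ m) k = Polynomial.coeff ((r \<cdot>\<^sub>v emb x) $ m) k"
      using m by (simp add: emb_def coeff_map_poly coeff_C0_smult orbit_fun_sum
          orbit_fun_grp_alg_scale vs_in_verts coeff_mult)
  qed
qed (simp add: emb_def)

lemma ret_emb:
  assumes x: "x \<in> carrier (C0_poly Y actV)"
  shows "ret (emb x) = x"
proof (rule poly_eqI)
  fix k
  have "Polynomial.coeff (ret (emb x)) k
      = (\<Sum>m<length vs. push (vs ! m) (orbit_fun (vs ! m) (Polynomial.coeff x k)))"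
    by (simp add: ret_def emb_def coeff_sum coeff_map_poly)
  also have "\<dots> = Polynomial.coeff x k"
    unfolding sum_vs[of "\<lambda>w. push w (orbit_fun w (Polynomial.coeff x k))"]
    using x by (intro sum_push_orbit_fun) (simp add: carrier_C0_poly)
  finally show "Polynomial.coeff (ret (emb x)) k = Polynomial.coeff x k" .
qed

lemma ret_closed: "ret v \<in> carrier (C0_poly Y actV)"
proof -
  have "Poly_Mapping.keys (\<Sum>m<length vs. Polynomial.coeff (map_poly (push (vs ! m)) (v $ m)) k) \<subseteq> verts Y" for k
    by (rule keys_sum_subset) (simp add: coeff_map_poly keys_push vs_in_verts)
  then show ?thesis by (simp add: carrier_C0_poly ret_def coeff_sum)
qed

text \<open>Linearity over the group algebra, applied to the chain \<open>r v\<close>. It exhibits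
  \<open>emb\<close> after \<open>ret\<close> as multiplication by the entries of
  \<open>idem\<close>.\<close>

lemma orbit_fun_push:
  assumes v: "v \<in> verts Y" and w: "w \<in> verts Y"
  shows "orbit_fun w (push v r) = orbit_fun w (Poly_Mapping.single v 1) * r"
proof (rule poly_mapping_eqI)
  fix h
  have "Poly_Mapping.lookup (orbit_fun w (Poly_Mapping.single v 1) * r) h = Poly_Mapping.lookup (r * orbit_fun w (Poly_Mapping.single v 1)) h"
    by (simp add: mult.commute)
  also have "\<dots> = (\<Sum>g\<in>UNIV. Poly_Mapping.lookup r g * (if v = actV (h - g) w then 1 else 0) / of_nat (card (UNIV :: 'g set)))"
    by (simp add: lookup_mult_finite lookup_single when_def)
  also have "\<dots> = Poly_Mapping.lookup (orbit_fun w (push v r)) h"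
    by (auto simp: lookup_push sum_divide_distrib actV_eq_iff v w intro!: sum.cong)
  finally show "Poly_Mapping.lookup (orbit_fun w (push v r)) h = Poly_Mapping.lookup (orbit_fun w (Poly_Mapping.single v 1) * r) h" by simp
qed

lemma emb_ret:
  assumes v: "v \<in> carrier_vec (length vs)"
  shows "emb (ret v) = idem *\<^sub>v v"
proof (rule eq_vecI)
  fix m assume "m < dim_vec (idem *\<^sub>v v)"
  then have m: "m < length vs" by (simp add: idem_def)
  show "emb (ret v) $ m = (idem *\<^sub>v v) $ m"
  proof (rule poly_eqI)
    fix k
    have "Polynomial.coeff (emb (ret v) $ m) k
        = (\<Sum>l<length vs. orbit_fun (vs ! m) (push (vs ! l) (Polynomial.coeff (v $ l) k)))"
      using m by (simp add: emb_def ret_def coeff_map_poly coeff_sum orbit_fun_sum)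
    also have "\<dots> = Polynomial.coeff ((idem *\<^sub>v v) $ m) k"
      using m v by (simp add: idem_def scalar_prod_def coeff_sum orbit_fun_push vs_in_verts
          lessThan_atLeast0)
    finally show "Polynomial.coeff (emb (ret v) $ m) k = Polynomial.coeff ((idem *\<^sub>v v) $ m) k" .
  qed
qed (simp add: emb_def idem_def)

end

section \<open>Adjacency and valency in the averaged coordinates\<close>

lemma lookup_single_zero_mult:
  fixes r :: "'g::{finite, ab_group_add} \<Rightarrow>\<^sub>0 complex"
  shows "Poly_Mapping.lookup (Poly_Mapping.single 0 c * r) h = c * Poly_Mapping.lookup r h"
proof -
  have "Poly_Mapping.lookup (Poly_Mapping.single 0 c * r) h = (\<Sum>g\<in>(UNIV :: 'g set). if g = 0 then c * Poly_Mapping.lookup r h else 0)"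
    unfolding lookup_mult_finite by (rule sum.cong) (auto simp: lookup_single when_def)
  then show ?thesis by simp
qed

text \<open>A quadratic polynomial in \<open>u\<close> looks back two coefficients, so the degrees 0
  and 1 are special.\<close>

lemma nat_cases_2:
  obtains "k = 0" | "k = Suc 0" | j where "k = Suc (Suc j)"
  by (metis not0_implies_Suc)

context finite_graph_action
begin

lemma sum_out_arcs: "(\<Sum>v\<in>verts Y. \<Sum>e\<in>out_arcs Y v. f e) = (\<Sum>e\<in>arcs Y. f e)"
  unfolding out_arcs_def by (rule sum.group) auto

lemma sum_arcs_bar: "(\<Sum>e\<in>arcs Y. f (bar e)) = (\<Sum>e\<in>arcs Y. f e)"
  by (rule sum.reindex_bij_witness[of _ bar bar]) auto

text \<open>Translation by \<open>g\<close> is a bijection from the arcs leaving \<open>w\<close> to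
  those leaving \<open>g w\<close>.\<close>

lemma sum_out_arcs_actV:
  assumes w: "w \<in> verts Y"
  shows "(\<Sum>e\<in>out_arcs Y (actV g w). f (head Y e)) = (\<Sum>e\<in>out_arcs Y w. f (actV g (head Y e)))"
proof (rule sum.reindex_bij_witness[of _ "actE g" "actE (- g)"])
  fix e assume e: "e \<in> out_arcs Y (actV g w)"
  show "actE g (actE (- g) e) = e" using e actE_add[of e g "- g"] actE_zero by simp
  show "actE (- g) e \<in> out_arcs Y w"
    using e w by (simp add: actE_closed tail_actE actV_cancel')
  show "f (actV g (head Y (actE (- g) e))) = f (head Y e)"
    using e by (simp add: head_actE actV_cancel)
next
  fix e assume e: "e \<in> out_arcs Y w"
  show "actE (- g) (actE g e) = e" using e actE_add[of e "- g" g] actE_zero by simp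
  show "actE g e \<in> out_arcs Y (actV g w)" using e by (simp add: actE_closed tail_actE)
qed

lemma out_degree_actV: "w \<in> verts Y \<Longrightarrow> out_degree Y (actV g w) = out_degree Y w"
  using sum_out_arcs_actV[of w "\<lambda>_. 1 :: nat" g] by (simp add: out_degree_def)

text \<open>By definition the coefficient at \<open>w\<close> collects the tails of the arcs that
  end in \<open>w\<close>; reversing these arcs turns them into the heads of the arcs that leave
  \<open>w\<close>.\<close>

lemma lookup_adj_op:
  assumes x: "Poly_Mapping.keys x \<subseteq> verts Y"
  shows "Poly_Mapping.lookup (adj_op Y x) w = (\<Sum>e\<in>out_arcs Y w. Poly_Mapping.lookup x (head Y e))"
proof -
  have "Poly_Mapping.lookup (adj_op Y x) w
      = (\<Sum>v\<in>Poly_Mapping.keys x. Poly_Mapping.lookup x v * (\<Sum>e\<in>out_arcs Y v. if head Y e = w then 1 else 0))"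
    by (simp add: adj_op_def lookup_lin_ext lookup_sum lookup_single when_def)
  also have "\<dots> = (\<Sum>v\<in>verts Y. Poly_Mapping.lookup x v * (\<Sum>e\<in>out_arcs Y v. if head Y e = w then 1 else 0))"
    using x by (intro sum.mono_neutral_left) (auto simp: in_keys_iff)
  also have "\<dots> = (\<Sum>v\<in>verts Y. \<Sum>e\<in>out_arcs Y v. if head Y e = w then Poly_Mapping.lookup x (tail Y e) else 0)"
    by (auto simp: sum_distrib_left intro!: sum.cong)
  also have "\<dots> = (\<Sum>e\<in>arcs Y. if head Y e = w then Poly_Mapping.lookup x (tail Y e) else 0)"
    by (rule sum_out_arcs)
  also have "\<dots> = (\<Sum>e\<in>arcs Y. if tail Y e = w then Poly_Mapping.lookup x (head Y e) else 0)"
    by (subst sum_arcs_bar[symmetric]) (auto intro!: sum.cong)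
  also have "\<dots> = (\<Sum>e\<in>out_arcs Y w. Poly_Mapping.lookup x (head Y e))"
    by (rule sum.mono_neutral_cong_right) auto
  finally show ?thesis .
qed

lemma lookup_val_op: "Poly_Mapping.lookup (val_op Y x) w = of_nat (out_degree Y w) * Poly_Mapping.lookup x w"
proof -
  have "Poly_Mapping.lookup (val_op Y x) w
      = (\<Sum>v\<in>Poly_Mapping.keys x. if v = w then Poly_Mapping.lookup x v * of_nat (out_degree Y v) else 0)"
    unfolding val_op_def lookup_lin_ext by (rule sum.cong) (auto simp: lookup_single when_def)
  also have "\<dots> = of_nat (out_degree Y w) * Poly_Mapping.lookup x w"
    by (auto simp: sum.delta in_keys_iff)
  finally show ?thesis .
qed

text \<open>Entry of the adjacency matrix; a loop counts with both of its directions.\<close>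

definition num_arcs :: "'v \<Rightarrow> 'v \<Rightarrow> complex" where
  "num_arcs w v = of_nat (card {e \<in> out_arcs Y w. head Y e = v})"

lemma sum_num_arcs: "(\<Sum>v\<in>verts Y. num_arcs w v * f v) = (\<Sum>e\<in>out_arcs Y w. f (head Y e))"
proof -
  have "(\<Sum>e\<in>out_arcs Y w. f (head Y e))
      = (\<Sum>v\<in>verts Y. \<Sum>e\<in>{e \<in> out_arcs Y w. head Y e = v}. f (head Y e))"
    by (rule sum.group[symmetric]) auto
  then show ?thesis by (simp add: num_arcs_def)
qed

text \<open>The star of \<open>h w\<close> is the translate of the star of \<open>w\<close>, so the
  same arc counts serve every \<open>h\<close>. Hence the coefficients are scalars, placed at the
  neutral element.\<close>

lemma orbit_fun_adj_op:
  assumes "Poly_Mapping.keys x \<subseteq> verts Y" "w \<in> verts Y"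
  shows "orbit_fun w (adj_op Y x) = (\<Sum>v\<in>verts Y. Poly_Mapping.single 0 (num_arcs w v) * orbit_fun v x)"
proof (rule poly_mapping_eqI)
  fix h
  show "Poly_Mapping.lookup (orbit_fun w (adj_op Y x)) h
      = Poly_Mapping.lookup (\<Sum>v\<in>verts Y. Poly_Mapping.single 0 (num_arcs w v) * orbit_fun v x) h"
    using assms sum_num_arcs[of w "\<lambda>v. Poly_Mapping.lookup x (actV h v) / of_nat (card (UNIV :: 'g set))"]
    by (simp add: lookup_sum lookup_single_zero_mult lookup_adj_op sum_out_arcs_actV sum_divide_distrib)
qed

lemma orbit_fun_val_op:
  assumes "w \<in> verts Y"
  shows "orbit_fun w (val_op Y x) = Poly_Mapping.single 0 (of_nat (out_degree Y w)) * orbit_fun w x"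
  using assms
  by (intro poly_mapping_eqI) (simp only: lookup_single_zero_mult lookup_orbit_fun lookup_val_op
      out_degree_actV times_divide_eq_right)

lemma op_zero [simp]: "adj_op Y 0 = 0" "val_op Y 0 = 0"
  by (simp_all add: adj_op_def val_op_def lin_ext_def)

lemma coeff_ihara_op:
  "Polynomial.coeff (ihara_op Y x) 0 = Polynomial.coeff x 0"
  "Polynomial.coeff (ihara_op Y x) (Suc 0) = Polynomial.coeff x (Suc 0) - adj_op Y (Polynomial.coeff x 0)"
  "Polynomial.coeff (ihara_op Y x) (Suc (Suc k)) = Polynomial.coeff x (Suc (Suc k))
     - adj_op Y (Polynomial.coeff x (Suc k)) + (val_op Y (Polynomial.coeff x k) - Polynomial.coeff x k)"
  by (simp_all add: ihara_op_def coeff_map_poly)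

lemma ihara_op_closed:
  assumes x: "x \<in> carrier (C0_poly Y actV)"
  shows "ihara_op Y x \<in> carrier (C0_poly Y actV)"
proof -
  have x: "Poly_Mapping.keys (Polynomial.coeff x i) \<subseteq> verts Y" for i
    using x by (simp add: carrier_C0_poly)
  have "Poly_Mapping.lookup (Polynomial.coeff (ihara_op Y x) k) w = 0" if w: "w \<notin> verts Y" for k w
  proof -
    have "out_arcs Y w = {}" using w by auto
    then have "Poly_Mapping.lookup (adj_op Y (Polynomial.coeff x i)) w = 0" for i
      by (simp add: lookup_adj_op[OF x])
    moreover have "Poly_Mapping.lookup (Polynomial.coeff x i) w = 0" for i
      using x w by (rule lookup_eq_0)
    ultimately show ?thesis
      by (cases k rule: nat_cases_2) (simp_all add: coeff_ihara_op lookup_minus lookup_add lookup_val_op)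
  qed
  then show ?thesis by (auto simp: carrier_C0_poly in_keys_iff)
qed

definition ihara_mat :: "complex poly mat" where
  "ihara_mat = mat (length vs) (length vs) (\<lambda>(m, l).
     [: of_bool (m = l), - num_arcs (vs ! m) (vs ! l),
        of_bool (m = l) * (of_nat (out_degree Y (vs ! m)) - 1) :])"

lemma emb_ihara_op:
  assumes x: "x \<in> carrier (C0_poly Y actV)"
  shows "emb (ihara_op Y x) = map_mat (map_poly (Poly_Mapping.single 0)) ihara_mat *\<^sub>v emb x"
proof (rule eq_vecI)
  fix m assume "m < dim_vec (map_mat (map_poly (Poly_Mapping.single 0)) ihara_mat *\<^sub>v emb x)"
  then have m: "m < length vs" by (simp add: ihara_mat_def)
  let ?o = "\<lambda>l k. orbit_fun (vs ! l) (Polynomial.coeff x k)"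
  have x: "Poly_Mapping.keys (Polynomial.coeff x i) \<subseteq> verts Y" for i
    using x by (simp add: carrier_C0_poly)
  have delta: "(\<Sum>l<length vs. Poly_Mapping.single 0 (of_bool (m = l) * c) * f l) = Poly_Mapping.single 0 c * f m"
    for c and f :: "nat \<Rightarrow> 'g \<Rightarrow>\<^sub>0 complex"
  proof -
    have "(\<Sum>l<length vs. Poly_Mapping.single 0 (of_bool (m = l) * c) * f l)
        = (\<Sum>l<length vs. if l = m then Poly_Mapping.single 0 c * f l else 0)"
      by (rule sum.cong) auto
    then show ?thesis using m by simp
  qed
  have delta1: "(\<Sum>l<length vs. Poly_Mapping.single 0 (of_bool (m = l)) * f l) = f m"
    for f :: "nat \<Rightarrow> 'g \<Rightarrow>\<^sub>0 complex"
    using delta[of 1 f] by simp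
  have delta_diff: "(\<Sum>l<length vs. Poly_Mapping.single 0 (of_bool (m = l) * (c - 1)) * f l) = Poly_Mapping.single 0 c * f m - f m"
    for c and f :: "nat \<Rightarrow> 'g \<Rightarrow>\<^sub>0 complex"
    unfolding delta by (simp add: single_diff left_diff_distrib)
  have adj: "orbit_fun (vs ! m) (adj_op Y (Polynomial.coeff x k))
      = (\<Sum>l<length vs. Poly_Mapping.single 0 (num_arcs (vs ! m) (vs ! l)) * ?o l k)" for k
    unfolding orbit_fun_adj_op[OF x vs_in_verts[OF m]]
    by (rule sum_vs[symmetric])
  have row: "(map_mat (map_poly (Poly_Mapping.single 0)) ihara_mat *\<^sub>v emb x) $ m
      = (\<Sum>l<length vs. [: Poly_Mapping.single 0 (of_bool (m = l)), Poly_Mapping.single 0 (- num_arcs (vs ! m) (vs ! l)),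
          Poly_Mapping.single 0 (of_bool (m = l) * (of_nat (out_degree Y (vs ! m)) - 1)) :]
          * map_poly (orbit_fun (vs ! l)) x)"
    using m by (simp add: ihara_mat_def emb_def scalar_prod_def lessThan_atLeast0 Polynomial.map_poly_pCons del: mult_pCons_left)
  show "emb (ihara_op Y x) $ m = (map_mat (map_poly (Poly_Mapping.single 0)) ihara_mat *\<^sub>v emb x) $ m"
  proof (rule poly_eqI)
    fix k
    have "Polynomial.coeff (emb (ihara_op Y x) $ m) k = orbit_fun (vs ! m) (Polynomial.coeff (ihara_op Y x) k)"
      using m by (simp add: emb_def coeff_map_poly)
    also have "\<dots> = Polynomial.coeff ((map_mat (map_poly (Poly_Mapping.single 0)) ihara_mat *\<^sub>v emb x) $ m) k"
      unfolding row using m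
      by (cases k rule: nat_cases_2)
        (simp_all add: coeff_ihara_op orbit_fun_add orbit_fun_diff adj orbit_fun_val_op vs_in_verts
          coeff_sum coeff_map_poly sum.distrib delta1 delta_diff single_uminus sum_negf sum_subtractf)
    finally show "Polynomial.coeff (emb (ihara_op Y x) $ m) k
        = Polynomial.coeff ((map_mat (map_poly (Poly_Mapping.single 0)) ihara_mat *\<^sub>v emb x) $ m) k" .
  qed
qed (simp add: emb_def ihara_mat_def)

lemma eta_eq_det:
  "eta Y actV = Determinant.det (1\<^sub>m (length vs) - idem + map_mat (map_poly (Poly_Mapping.single 0)) ihara_mat * idem)"
  unfolding eta_def
proof (rule proj_det_eqI, rule is_proj_det_retract[where \<iota> = emb and \<pi> = ret])
  let ?M = "C0_poly Y actV"
  show "\<zero>\<^bsub>?M\<^esub> \<in> carrier ?M" "emb \<zero>\<^bsub>?M\<^esub> = 0\<^sub>v (length vs)"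
    by (auto simp: C0_poly_def emb_def)
  fix x assume x: "x \<in> carrier ?M"
  show "emb x \<in> carrier_vec (length vs)" by (simp add: emb_def)
  show "r \<odot>\<^bsub>?M\<^esub> x \<in> carrier ?M" for r
  proof -
    have "Poly_Mapping.keys (\<Sum>i\<le>k. grp_alg_scale actV (Polynomial.coeff r i) (Polynomial.coeff x (k - i))) \<subseteq> verts Y" for k
      using x by (intro keys_sum_subset keys_grp_alg_scale) (simp add: carrier_C0_poly)
    then show ?thesis by (simp add: carrier_C0_poly coeff_C0_smult)
  qed
  fix y assume y: "y \<in> carrier ?M"
  have add: "x \<oplus>\<^bsub>?M\<^esub> y = x + y" by (simp add: C0_poly_def)
  have "Poly_Mapping.keys (Polynomial.coeff x i + Polynomial.coeff y i) \<subseteq> verts Y" for i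
    using x y keys_add[of "Polynomial.coeff x i" "Polynomial.coeff y i"]
    unfolding carrier_C0_poly by blast
  then show "x \<oplus>\<^bsub>?M\<^esub> y \<in> carrier ?M" by (simp add: add carrier_C0_poly)
  show "emb (x \<oplus>\<^bsub>?M\<^esub> y) = emb x + emb y"
    by (intro eq_vecI) (auto simp: add emb_def coeff_map_poly orbit_fun_add intro!: poly_eqI)
qed (auto simp: emb_smult ret_emb emb_ret emb_ihara_op ihara_op_closed ret_closed idem_def ihara_mat_def)

section \<open>Specialisation at a character\<close>

text \<open>The image of \<open>idem\<close> under \<psi>: the projector onto the chains
  \<open>x\<close> with \<open>g x = \<psi>(g) x\<close> for all \<open>g\<close>.\<close>

definition char_proj :: "('g \<Rightarrow> complex) \<Rightarrow> complex mat" where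
  "char_proj \<psi> = mat (length vs) (length vs) (\<lambda>(m, l).
     (\<Sum>g\<in>UNIV. if actV g (vs ! m) = vs ! l then \<psi> g else 0) / of_nat (card (UNIV :: 'g set)))"

text \<open>Ring homomorphisms commute with determinants. The scalar matrix is unchanged because a
  character is 1 at the neutral element.\<close>

lemma h_poly_eq_det:
  assumes \<psi>: "is_character \<psi>"
  shows "h_poly Y actV \<psi> = Determinant.det (1\<^sub>m (length vs) - map_mat (\<lambda>c. [:c:]) (char_proj \<psi>)
    + ihara_mat * map_mat (\<lambda>c. [:c:]) (char_proj \<psi>))"
proof -
  interpret \<psi>: comm_ring_hom "char_ext \<psi>" by (rule comm_ring_hom_char_ext[OF \<psi>])
  interpret \<psi>p: map_poly_comm_ring_hom "char_ext \<psi>" ..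
  let ?h = "map_poly (char_ext \<psi>)"
  let ?F = "map_mat (map_poly (Poly_Mapping.single 0)) ihara_mat :: ('g \<Rightarrow>\<^sub>0 complex) poly mat"
  have idem: "idem \<in> carrier_mat (length vs) (length vs)"
    and F: "?F \<in> carrier_mat (length vs) (length vs)"
    by (auto simp: idem_def ihara_mat_def)
  have hF: "map_mat ?h ?F = ihara_mat"
  proof (rule eq_matI)
    fix i j assume "i < dim_row ihara_mat" "j < dim_col ihara_mat"
    moreover have "?h (map_poly (Poly_Mapping.single 0) p) = p" for p
      using character_zero[OF \<psi>] by (intro poly_eqI) (simp add: coeff_map_poly char_ext_single)
    ultimately show "map_mat ?h ?F $$ (i, j) = ihara_mat $$ (i, j)" by simp
  qed auto
  have hE: "map_mat ?h idem = map_mat (\<lambda>c. [:c:]) (char_proj \<psi>)"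
  proof (rule eq_matI)
    fix i j
    assume "i < dim_row (map_mat (\<lambda>c. [:c:]) (char_proj \<psi>))" "j < dim_col (map_mat (\<lambda>c. [:c:]) (char_proj \<psi>))"
    then show "map_mat ?h idem $$ (i, j) = map_mat (\<lambda>c. [:c:]) (char_proj \<psi>) $$ (i, j)"
      by (auto simp: idem_def char_proj_def Polynomial.map_poly_pCons char_ext_eq_sum_UNIV lookup_single when_def
          sum_divide_distrib intro!: sum.cong)
  qed (auto simp: idem_def char_proj_def)
  have "map_mat ?h (1\<^sub>m (length vs) - idem + ?F * idem)
      = 1\<^sub>m (length vs) - map_mat ?h idem + map_mat ?h (?F * idem)"
    using idem F by (intro eq_matI) (auto simp: \<psi>p.hom_add \<psi>p.hom_minus)
  also have "map_mat ?h (?F * idem) = map_mat ?h ?F * map_mat ?h idem"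
    using F idem by (rule \<psi>p.mat_hom_mult)
  finally show ?thesis
    unfolding h_poly_def eta_eq_det \<psi>p.hom_det[symmetric] hF hE by simp
qed

end

section \<open>The order of vanishing at \<open>u = 1\<close>\<close>

lemma sum_character_eq_0:
  fixes \<psi> :: "'g::{finite, ab_group_add} \<Rightarrow> complex"
  assumes \<psi>: "is_character \<psi>" and nontriv: "\<psi> \<noteq> trivial_character"
  shows "(\<Sum>g\<in>UNIV. \<psi> g) = 0"
proof -
  obtain h where h: "\<psi> h \<noteq> 1"
    using nontriv by (auto simp: trivial_character_def)
  have "(\<Sum>g\<in>UNIV. \<psi> g) = (\<Sum>g\<in>UNIV. \<psi> (h + g))"
    by (rule sum.reindex_bij_witness[of _ "\<lambda>g. h + g" "\<lambda>g. g - h"]) auto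
  also have "\<dots> = \<psi> h * (\<Sum>g\<in>UNIV. \<psi> g)"
    using \<psi> by (simp add: is_character_def sum_distrib_left)
  finally have "(1 - \<psi> h) * (\<Sum>g\<in>UNIV. \<psi> g) = 0" by (simp add: left_diff_distrib)
  then show ?thesis using h by simp
qed

lemma sum_pCons3: "(\<Sum>x\<in>A. [:f x, g x, h x:]) = [:\<Sum>x\<in>A. f x, \<Sum>x\<in>A. g x, \<Sum>x\<in>A. h x:]"
  by (induction A rule: infinite_finite_induct) auto

lemma is_character_trivial: "is_character trivial_character"
  by (simp add: is_character_def trivial_character_def)

text \<open>Adding every other row to row 0 keeps the determinant and makes row 0 equal to
  \<open>c * q j\<close>, from which \<open>c\<close> comes out. Nothing is divided, so
  \<open>c\<close> may be any ring element.\<close>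

lemma det_col_sums_factor:
  fixes P :: "'a::comm_ring_1 mat"
  assumes P: "P \<in> carrier_mat n n" and n: "0 < n"
    and sums: "\<And>j. j < n \<Longrightarrow> (\<Sum>i<n. P $$ (i, j)) = c * q j"
  shows "Determinant.det P = c * Determinant.det (mat n n (\<lambda>(i, j). if i = 0 then q j else P $$ (i, j)))"
proof -
  define R where "R = mat n n (\<lambda>(i, j). if i = 0 \<or> i = j then 1 else 0 :: 'a)"
  define Q where "Q = mat n n (\<lambda>(i, j). if i = 0 then q j else P $$ (i, j))"
  have R: "R \<in> carrier_mat n n" and Q: "Q \<in> carrier_mat n n" by (simp_all add: R_def Q_def)
  have "Determinant.det R = prod_list (diag_mat R)"
    by (rule det_upper_triangular[OF _ R]) (auto simp: R_def upper_triangular_def)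
  also have "\<dots> = 1"
    by (simp add: prod_list_diag_prod R_def)
  finally have R1: "Determinant.det R = 1" .
  have "R * P = multrow 0 c Q"
  proof (rule eq_matI)
    fix i j assume "i < dim_row (multrow 0 c Q)" "j < dim_col (multrow 0 c Q)"
    then have ij: "i < n" "j < n" by (simp_all add: Q_def)
    have "(R * P) $$ (i, j) = (\<Sum>k<n. (if i = 0 \<or> i = k then 1 else 0) * P $$ (k, j))"
      using ij P by (simp add: R_def scalar_prod_def lessThan_atLeast0)
    also have "\<dots> = (if i = 0 then c * q j else P $$ (i, j))"
    proof (cases "i = 0")
      case False
      then have "(\<Sum>k<n. (if i = 0 \<or> i = k then 1 else 0) * P $$ (k, j))
          = (\<Sum>k<n. if k = i then P $$ (k, j) else 0)"
        by (intro sum.cong) auto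
      then show ?thesis using False ij by simp
    qed (use sums ij in simp)
    finally show "(R * P) $$ (i, j) = multrow 0 c Q $$ (i, j)"
      using ij by (simp add: Q_def)
  qed (use P R in \<open>simp_all add: Q_def R_def\<close>)
  then show ?thesis
    using det_mult[OF R P] R1 det_multrow[OF n Q, of c] by (simp add: Q_def)
qed

text \<open>Reversal has no fixed arcs, so the undirected edges partition the arcs into
  pairs.\<close>

lemma (in bidirected_digraph) card_arcs_eq:
  assumes "finite (arcs G)"
  shows "card (arcs G) = 2 * card (undirected_edges G arev)"
proof -
  have U: "\<Union> (undirected_edges G arev) = arcs G"
    by (auto simp: undirected_edges_def)
  have "2 * card (undirected_edges G arev) = card (\<Union> (undirected_edges G arev))"
  proof (rule card_partition)
    show "finite (undirected_edges G arev)" using assms by (simp add: undirected_edges_def)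
    show "finite (\<Union> (undirected_edges G arev))" using assms U by simp
    show "card c = 2" if "c \<in> undirected_edges G arev" for c
    proof -
      obtain a where "a \<in> arcs G" "c = {a, arev a}"
        using \<open>c \<in> undirected_edges G arev\<close> by (auto simp: undirected_edges_def)
      then show ?thesis using arev_neq[of a] unfolding card_2_iff by metis
    qed
    show "c \<inter> c' = {}"
      if cc: "c \<in> undirected_edges G arev" "c' \<in> undirected_edges G arev" "c \<noteq> c'" for c c'
    proof (rule ccontr)
      assume "c \<inter> c' \<noteq> {}"
      moreover obtain a a' where c: "c = {a, arev a}" "c' = {a', arev a'}"
        using cc by (auto simp: undirected_edges_def)
      ultimately have "a = a' \<or> a = arev a' \<or> arev a = a' \<or> arev a = arev a'" by auto
      then have "a = a' \<or> a = arev a'" by (metis arev_arev)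
      then show False using cc(3) c by auto
    qed
  qed
  then show ?thesis using U by simp
qed

section \<open>Harmonic functions and the kernel at \<open>u = 1\<close>\<close>

context finite_graph_action
begin

text \<open>The Laplacian \<open>D - A\<close>, on functions of vertices instead of index vectors,
  so that the group acts on the argument directly.\<close>

definition lap_fun :: "('v \<Rightarrow> complex) \<Rightarrow> 'v \<Rightarrow> complex" where
  "lap_fun X w = of_nat (out_degree Y w) * X w - (\<Sum>e\<in>out_arcs Y w. X (head Y e))"

definition proj_fun :: "('g \<Rightarrow> complex) \<Rightarrow> ('v \<Rightarrow> complex) \<Rightarrow> 'v \<Rightarrow> complex" where
  "proj_fun \<psi> X w = (\<Sum>g\<in>UNIV. \<psi> g * X (actV g w)) / of_nat (card (UNIV :: 'g set))"

lemma lap_fun_cong: "(\<And>w. w \<in> verts Y \<Longrightarrow> X w = Z w) \<Longrightarrow> w \<in> verts Y \<Longrightarrow> lap_fun X w = lap_fun Z w"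
  unfolding lap_fun_def by (auto intro!: sum.cong)

text \<open>The action preserves valencies and carries stars to stars, so the Laplacian commutes
  with every translation and with weighted sums of translations.\<close>

lemma lap_fun_proj_fun:
  assumes w: "w \<in> verts Y"
  shows "lap_fun (proj_fun \<psi> X) w = proj_fun \<psi> (lap_fun X) w"
proof -
  have "(\<Sum>g\<in>UNIV. \<psi> g * lap_fun X (actV g w))
      = (\<Sum>g\<in>UNIV. of_nat (out_degree Y w) * (\<psi> g * X (actV g w))
          - (\<Sum>e\<in>out_arcs Y w. \<psi> g * X (actV g (head Y e))))"
    using w by (intro sum.cong refl)
      (simp add: lap_fun_def out_degree_actV sum_out_arcs_actV right_diff_distrib sum_distrib_left)
  also have "\<dots> = of_nat (out_degree Y w) * (\<Sum>g\<in>UNIV. \<psi> g * X (actV g w))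
      - (\<Sum>e\<in>out_arcs Y w. \<Sum>g\<in>UNIV. \<psi> g * X (actV g (head Y e)))"
    by (simp add: sum_subtractf sum_distrib_left) (rule sum.swap)
  also have "\<dots> / of_nat (card (UNIV :: 'g set)) = lap_fun (proj_fun \<psi> X) w"
    by (simp add: lap_fun_def proj_fun_def diff_divide_distrib flip: sum_divide_distrib)
  finally show ?thesis by (simp add: proj_fun_def[of \<psi> "lap_fun X"])
qed

lemma proj_fun_idem:
  assumes \<psi>: "is_character \<psi>" and w: "w \<in> verts Y"
  shows "proj_fun \<psi> (proj_fun \<psi> X) w = proj_fun \<psi> X w"
proof -
  have "(\<Sum>h\<in>UNIV. \<psi> g * (\<psi> h * X (actV h (actV g w)))) = (\<Sum>h\<in>UNIV. \<psi> h * X (actV h w))" for g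
    using \<psi> w by (intro sum.reindex_bij_witness[of _ "\<lambda>h. h - g" "\<lambda>h. h + g"])
      (auto simp: is_character_def actV_add)
  moreover have "proj_fun \<psi> (proj_fun \<psi> X) w
      = (\<Sum>g\<in>UNIV. \<Sum>h\<in>UNIV. \<psi> g * (\<psi> h * X (actV h (actV g w)))) / of_nat (card (UNIV :: 'g set)) / of_nat (card (UNIV :: 'g set))"
    by (simp add: proj_fun_def sum_distrib_left sum_divide_distrib)
  ultimately show ?thesis by (simp add: proj_fun_def)
qed

text \<open>At \<open>u = 1\<close> the identity cancels in \<open>I - A u + (D - I) u^2\<close>,
  which leaves the Laplacian.\<close>

definition lap_mat :: "complex mat" where
  "lap_mat = map_mat (\<lambda>p. poly p 1) ihara_mat"

definition vert_vec :: "('v \<Rightarrow> complex) \<Rightarrow> complex vec" where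
  "vert_vec X = vec (length vs) (\<lambda>m. X (vs ! m))"

lemma obtain_vert_vec:
  assumes "x \<in> carrier_vec (length vs)"
  obtains X where "x = vert_vec X"
proof
  have "inj_on ((!) vs) {..<length vs}"
    using distinct_vs by (auto simp: inj_on_def nth_eq_iff_index_eq)
  then show "x = vert_vec (\<lambda>w. x $ (the_inv_into {..<length vs} ((!) vs) w))"
    using assms by (intro eq_vecI) (simp_all add: vert_vec_def the_inv_into_f_f)
qed

lemma vert_vec_eq_iff: "vert_vec X = vert_vec Z \<longleftrightarrow> (\<forall>w\<in>verts Y. X w = Z w)"
  by (auto simp: vert_vec_def vec_eq_iff set_vs[symmetric] all_set_conv_all_nth)

lemma lap_mat_vert_vec: "lap_mat *\<^sub>v vert_vec X = vert_vec (lap_fun X)"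
proof (rule eq_vecI)
  fix m assume "m < dim_vec (vert_vec (lap_fun X))"
  then have m: "m < length vs" by (simp add: vert_vec_def)
  have "(lap_mat *\<^sub>v vert_vec X) $ m
      = (\<Sum>l<length vs. (if l = m then of_nat (out_degree Y (vs ! m)) * X (vs ! l) else 0)
          - num_arcs (vs ! m) (vs ! l) * X (vs ! l))"
    using m unfolding lap_mat_def ihara_mat_def vert_vec_def
    by (auto simp: scalar_prod_def lessThan_atLeast0 algebra_simps intro!: sum.cong)
  also have "\<dots> = of_nat (out_degree Y (vs ! m)) * X (vs ! m)
      - (\<Sum>l<length vs. num_arcs (vs ! m) (vs ! l) * X (vs ! l))"
    using m by (simp add: sum_subtractf)
  also have "\<dots> = vert_vec (lap_fun X) $ m"
    using m sum_vs[of "\<lambda>v. num_arcs (vs ! m) v * X v"]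
    by (simp add: vert_vec_def lap_fun_def sum_num_arcs)
  finally show "(lap_mat *\<^sub>v vert_vec X) $ m = vert_vec (lap_fun X) $ m" .
qed (simp add: lap_mat_def ihara_mat_def vert_vec_def)

lemma char_proj_vert_vec: "char_proj \<psi> *\<^sub>v vert_vec X = vert_vec (proj_fun \<psi> X)"
proof (rule eq_vecI)
  fix m assume "m < dim_vec (vert_vec (proj_fun \<psi> X))"
  then have m: "m < length vs" by (simp add: vert_vec_def)
  have "(char_proj \<psi> *\<^sub>v vert_vec X) $ m
      = (\<Sum>l<length vs. (\<Sum>g\<in>UNIV. if actV g (vs ! m) = vs ! l then \<psi> g else 0) / of_nat (card (UNIV :: 'g set)) * X (vs ! l))"
    using m by (simp add: char_proj_def vert_vec_def scalar_prod_def lessThan_atLeast0)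
  also have "\<dots> = (\<Sum>v\<in>verts Y. (\<Sum>g\<in>UNIV. if actV g (vs ! m) = v then \<psi> g else 0) / of_nat (card (UNIV :: 'g set)) * X v)"
    by (rule sum_vs)
  also have "\<dots> = (\<Sum>v\<in>verts Y. \<Sum>g\<in>UNIV. if v = actV g (vs ! m) then \<psi> g * X v / of_nat (card (UNIV :: 'g set)) else 0)"
    by (auto simp: sum_divide_distrib sum_distrib_right intro!: sum.cong)
  also have "\<dots> = (\<Sum>g\<in>UNIV. \<Sum>v\<in>verts Y. if v = actV g (vs ! m) then \<psi> g * X v / of_nat (card (UNIV :: 'g set)) else 0)"
    by (rule sum.swap)
  also have "\<dots> = vert_vec (proj_fun \<psi> X) $ m"
    using m by (simp add: vs_in_verts actV_closed vert_vec_def proj_fun_def sum_divide_distrib)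
  finally show "(char_proj \<psi> *\<^sub>v vert_vec X) $ m = vert_vec (proj_fun \<psi> X) $ m" .
qed (simp add: char_proj_def vert_vec_def)

text \<open>The Dirichlet energy: pairing \<open>X\<close> with its Laplacian and symmetrising over
  arc reversal gives the sum of the squared differences along the arcs. If it is zero,
  \<open>X\<close> is constant along every arc, hence on a connected graph.\<close>

lemma harmonic_imp_constant:
  assumes conn: "Digraph_Component.connected Y"
    and harm: "\<And>w. w \<in> verts Y \<Longrightarrow> lap_fun X w = 0"
  obtains c where "\<And>w. w \<in> verts Y \<Longrightarrow> X w = c"
proof -
  let ?t = "\<lambda>e. X (tail Y e)" and ?h = "\<lambda>e. X (head Y e)"
  have "0 = (\<Sum>w\<in>verts Y. cnj (X w) * lap_fun X w)" using harm by simp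
  also have "\<dots> = (\<Sum>w\<in>verts Y. \<Sum>e\<in>out_arcs Y w. cnj (?t e) * (?t e - ?h e))"
  proof (rule sum.cong[OF refl])
    fix w
    have "(\<Sum>e\<in>out_arcs Y w. cnj (?t e) * (?t e - ?h e)) = (\<Sum>e\<in>out_arcs Y w. cnj (X w) * (X w - ?h e))"
      by (rule sum.cong) auto
    then show "cnj (X w) * lap_fun X w = (\<Sum>e\<in>out_arcs Y w. cnj (?t e) * (?t e - ?h e))"
      by (simp add: lap_fun_def out_degree_def sum_subtractf flip: sum_distrib_left)
  qed
  also have "\<dots> = (\<Sum>e\<in>arcs Y. cnj (?t e) * (?t e - ?h e))" by (rule sum_out_arcs)
  finally have 1: "(\<Sum>e\<in>arcs Y. cnj (?t e) * (?t e - ?h e)) = 0" by simp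
  \<comment> \<open>The same sum over reversed arcs; added to the first it completes each term to a
    squared modulus.\<close>
  have "(\<Sum>e\<in>arcs Y. cnj (?h e) * (?h e - ?t e)) = (\<Sum>e\<in>arcs Y. cnj (?t (bar e)) * (?t (bar e) - ?h (bar e)))"
    by (rule sum.cong) auto
  also have "\<dots> = 0" unfolding sum_arcs_bar[of "\<lambda>e. cnj (?t e) * (?t e - ?h e)"] by (rule 1)
  finally have "(\<Sum>e\<in>arcs Y. cnj (?t e) * (?t e - ?h e) + cnj (?h e) * (?h e - ?t e)) = 0"
    using 1 by (simp add: sum.distrib)
  moreover have "cnj a * (a - b) + cnj b * (b - a) = of_real ((cmod (a - b))\<^sup>2)" for a b :: complex
    unfolding complex_norm_square by (simp add: algebra_simps)
  ultimately have "complex_of_real (\<Sum>e\<in>arcs Y. (cmod (?t e - ?h e))\<^sup>2) = 0" by simp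
  then have "(\<Sum>e\<in>arcs Y. (cmod (?t e - ?h e))\<^sup>2) = 0" by (simp only: of_real_eq_0_iff)
  then have arc: "?t e = ?h e" if "e \<in> arcs Y" for e
    using that by (simp add: sum_nonneg_eq_0_iff)
  \<comment> \<open>Every arc has a reverse, so connectedness yields directed paths, along which the
    equality of values propagates.\<close>
  have sc: "strongly_connected Y"
    using sym_arcs conn by (rule symmetric_connected_imp_strongly_connected)
  then obtain u where u: "u \<in> verts Y" by (auto simp: strongly_connected_def)
  have "X w = X u" if "w \<in> verts Y" for w
  proof -
    have "u \<rightarrow>\<^sup>*\<^bsub>Y\<^esub> w" using sc u that by (auto simp: strongly_connected_def)
    then show ?thesis
    proof (induction rule: reachable_induct)
      case (step v w)
      then show ?case using arc by (auto simp: arcs_ends_conv)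
    qed simp
  qed
  then show thesis by (rule that)
qed

lemma char_proj_carrier: "char_proj \<psi> \<in> carrier_mat (length vs) (length vs)"
  and lap_mat_carrier: "lap_mat \<in> carrier_mat (length vs) (length vs)"
  and ihara_mat_carrier: "ihara_mat \<in> carrier_mat (length vs) (length vs)"
  by (auto simp: char_proj_def lap_mat_def ihara_mat_def)

text \<open>With \<open>Z\<close> the projection of \<open>X\<close> and \<open>L\<close> the
  Laplacian, the kernel equation reads \<open>X = Z - L Z\<close>. The projector is idempotent and
  commutes with \<open>L\<close>, so applying it gives \<open>Z = Z - L Z\<close>; thus
  \<open>L Z = 0\<close> and \<open>X = Z\<close>.\<close>

lemma kernel_at_one:
  assumes conn: "Digraph_Component.connected Y" and \<psi>: "is_character \<psi>"
    and x: "x \<in> carrier_vec (length vs)"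
    and ker: "(1\<^sub>m (length vs) - char_proj \<psi> + lap_mat * char_proj \<psi>) *\<^sub>v x = 0\<^sub>v (length vs)"
  obtains c where "x = vert_vec (\<lambda>_. c)" "\<psi> \<noteq> trivial_character \<longrightarrow> c = 0"
proof -
  obtain X where X: "x = vert_vec X" using x by (rule obtain_vert_vec)
  let ?Z = "proj_fun \<psi> X"
  have "(1\<^sub>m (length vs) - char_proj \<psi> + lap_mat * char_proj \<psi>) *\<^sub>v x
      = (1\<^sub>m (length vs) - char_proj \<psi>) *\<^sub>v x + (lap_mat * char_proj \<psi>) *\<^sub>v x"
    by (rule add_mult_distrib_mat_vec[OF minus_carrier_mat[OF char_proj_carrier]
          mult_carrier_mat[OF lap_mat_carrier char_proj_carrier] x])
  also have "(1\<^sub>m (length vs) - char_proj \<psi>) *\<^sub>v x = x - char_proj \<psi> *\<^sub>v x"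
    using x minus_mult_distrib_mat_vec[OF one_carrier_mat char_proj_carrier x] by simp
  also have "(lap_mat * char_proj \<psi>) *\<^sub>v x = lap_mat *\<^sub>v (char_proj \<psi> *\<^sub>v x)"
    by (rule assoc_mult_mat_vec[OF lap_mat_carrier char_proj_carrier x])
  finally have "x - char_proj \<psi> *\<^sub>v x + lap_mat *\<^sub>v (char_proj \<psi> *\<^sub>v x) = 0\<^sub>v (length vs)"
    using ker by simp
  then have "vert_vec (\<lambda>w. X w - ?Z w + lap_fun ?Z w) = vert_vec (\<lambda>_. 0)"
    unfolding X char_proj_vert_vec lap_mat_vert_vec
    by (auto simp: vec_eq_iff vert_vec_def)
  then have eq: "X w = ?Z w - lap_fun ?Z w" if "w \<in> verts Y" for w
    using that unfolding vert_vec_eq_iff by (simp add: algebra_simps eq_neg_iff_add_eq_0)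
  have lap0: "lap_fun ?Z w = 0" if w: "w \<in> verts Y" for w
  proof -
    have "?Z w = (\<Sum>g\<in>UNIV. \<psi> g * (?Z (actV g w) - lap_fun ?Z (actV g w))) / of_nat (card (UNIV :: 'g set))"
      unfolding proj_fun_def[of \<psi> X w] using eq w by (simp add: actV_closed)
    also have "\<dots> = proj_fun \<psi> ?Z w - proj_fun \<psi> (lap_fun ?Z) w"
      unfolding proj_fun_def[of \<psi> ?Z w] proj_fun_def[of \<psi> "lap_fun ?Z" w]
      by (simp add: right_diff_distrib sum_subtractf diff_divide_distrib)
    also have "proj_fun \<psi> (lap_fun ?Z) w = lap_fun (proj_fun \<psi> ?Z) w"
      using lap_fun_proj_fun[OF w] by simp
    also have "\<dots> = lap_fun ?Z w"
      using w proj_fun_idem[OF \<psi>] by (intro lap_fun_cong)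
    also have "proj_fun \<psi> ?Z w = ?Z w" by (rule proj_fun_idem[OF \<psi> w])
    finally show ?thesis by simp
  qed
  then obtain c where c: "\<And>w. w \<in> verts Y \<Longrightarrow> ?Z w = c"
    using harmonic_imp_constant[OF conn] by blast
  have Xc: "X w = c" if "w \<in> verts Y" for w using eq lap0 c that by simp
  show thesis
  proof (rule that[of c])
    show "x = vert_vec (\<lambda>_. c)" unfolding X vert_vec_eq_iff using Xc by simp
    show "\<psi> \<noteq> trivial_character \<longrightarrow> c = 0"
    proof
      assume "\<psi> \<noteq> trivial_character"
      then have \<psi>0: "(\<Sum>g\<in>UNIV. \<psi> g) = 0" by (rule sum_character_eq_0[OF \<psi>])
      obtain w where w: "w \<in> verts Y"
        using conn by (auto simp: connected_conv)
      \<comment> \<open>\<open>X\<close> and its projection are both the constant \<open>c\<close>,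
        so \<open>c\<close> equals itself times the mean of the character.\<close>
      have "c = (\<Sum>g\<in>UNIV. \<psi> g * c) / of_nat (card (UNIV :: 'g set))"
        using c[OF w] Xc w by (simp add: proj_fun_def actV_closed)
      also have "\<dots> = 0" using \<psi>0 by (simp flip: sum_distrib_right)
      finally show "c = 0" .
    qed
  qed
qed

section \<open>Evaluation at \<open>u = 1\<close> and non-trivial characters\<close>

abbreviation "twisted_mat \<psi> \<equiv> 1\<^sub>m (length vs) - map_mat (\<lambda>c. [:c:]) (char_proj \<psi>)
    + ihara_mat * map_mat (\<lambda>c. [:c:]) (char_proj \<psi>)"

lemma twisted_mat_carrier: "twisted_mat \<psi> \<in> carrier_mat (length vs) (length vs)"
  using char_proj_carrier[of \<psi>] ihara_mat_carrier by auto

lemma twisted_mat_at_one: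
  "map_mat (\<lambda>p. poly p 1) (twisted_mat \<psi>) = 1\<^sub>m (length vs) - char_proj \<psi> + lap_mat * char_proj \<psi>"
proof -
  let ?E = "map_mat (\<lambda>c. [:c:]) (char_proj \<psi>)"
  have E: "?E \<in> carrier_mat (length vs) (length vs)" using char_proj_carrier by simp
  have hE: "map_mat (\<lambda>p. poly p 1) ?E = char_proj \<psi>" by (intro eq_matI) auto
  have "map_mat (\<lambda>p. poly p 1) (twisted_mat \<psi>)
      = 1\<^sub>m (length vs) - map_mat (\<lambda>p. poly p 1) ?E + map_mat (\<lambda>p. poly p 1) (ihara_mat * ?E)"
    using E ihara_mat_carrier by (intro eq_matI) (auto split: if_splits)
  also have "map_mat (\<lambda>p. poly p 1) (ihara_mat * ?E) = lap_mat * map_mat (\<lambda>p. poly p 1) ?E"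
    unfolding lap_mat_def using ihara_mat_carrier E by (rule semiring_hom.mat_hom_mult[OF poly_hom.semiring_hom_axioms])
  finally show ?thesis by (simp only: hE)
qed

lemma h_poly_nontrivial_at_one:
  assumes "Digraph_Component.connected Y" "is_character \<psi>" "\<psi> \<noteq> trivial_character"
  shows "poly (h_poly Y actV \<psi>) 1 \<noteq> 0"
proof
  let ?A = "1\<^sub>m (length vs) - char_proj \<psi> + lap_mat * char_proj \<psi>"
  have A: "?A \<in> carrier_mat (length vs) (length vs)"
    using char_proj_carrier[of \<psi>] lap_mat_carrier by auto
  assume "poly (h_poly Y actV \<psi>) 1 = 0"
  then have "Determinant.det ?A = 0"
    unfolding h_poly_eq_det[OF assms(2)] comm_ring_hom.hom_det[OF poly_hom.comm_ring_hom_axioms, symmetric] twisted_mat_at_one .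
  then obtain x where x: "x \<in> carrier_vec (length vs)" "x \<noteq> 0\<^sub>v (length vs)" "?A *\<^sub>v x = 0\<^sub>v (length vs)"
    using det_0_iff_vec_prod_zero[OF A] by blast
  obtain c where "x = vert_vec (\<lambda>_. c)" "\<psi> \<noteq> trivial_character \<longrightarrow> c = 0"
    using kernel_at_one[OF assms(1,2) x(1,3)] .
  then have "x = 0\<^sub>v (length vs)" using assms(3) by (intro eq_vecI) (auto simp: vert_vec_def)
  with x(2) show False ..
qed

section \<open>The trivial character: a simple zero\<close>

text \<open>For the trivial character the projector averages over orbits. Column \<open>l\<close> is
  supported on the orbit of \<open>vs ! l\<close>, where an invariant \<open>f\<close> is constant,
  and the column sums to 1.\<close>

lemma sum_invariant_char_proj:
  assumes l: "l < length vs" and f: "\<And>g w. w \<in> verts Y \<Longrightarrow> f (actV g w) = f w"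
  shows "(\<Sum>k<length vs. f (vs ! k) * [:char_proj trivial_character $$ (k, l):]) = f (vs ! l)"
proof -
  let ?v = "vs ! l"
  have v: "?v \<in> verts Y" using l by (rule vs_in_verts)
  have "(\<Sum>k<length vs. f (vs ! k) * [:char_proj trivial_character $$ (k, l):])
      = (\<Sum>k<length vs. f (vs ! k) * [:(\<Sum>g\<in>(UNIV :: 'g set). if actV g (vs ! k) = ?v then 1 else 0) / of_nat (card (UNIV :: 'g set)):])"
    using l by (intro sum.cong) (auto simp: char_proj_def trivial_character_def)
  also have "\<dots> = (\<Sum>w\<in>verts Y. f w * [:(\<Sum>g\<in>(UNIV :: 'g set). if actV g w = ?v then 1 else 0) / of_nat (card (UNIV :: 'g set)):])"
    by (rule sum_vs)
  also have "\<dots> = (\<Sum>w\<in>verts Y. f ?v * [:(\<Sum>g\<in>(UNIV :: 'g set). if actV g w = ?v then 1 else 0) / of_nat (card (UNIV :: 'g set)):])"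
  proof (rule sum.cong[OF refl])
    fix w assume w: "w \<in> verts Y"
    show "f w * [:(\<Sum>g\<in>(UNIV :: 'g set). if actV g w = ?v then 1 else 0) / of_nat (card (UNIV :: 'g set)):]
        = f ?v * [:(\<Sum>g\<in>(UNIV :: 'g set). if actV g w = ?v then 1 else 0) / of_nat (card (UNIV :: 'g set)):]"
    proof (cases "\<exists>g. actV g w = ?v")
      case True
      then have "f w = f ?v" using f w by metis
      then show ?thesis by simp
    qed simp
  qed
  also have "\<dots> = f ?v * [:(\<Sum>w\<in>verts Y. \<Sum>g\<in>(UNIV :: 'g set). if actV g w = ?v then 1 else 0) / of_nat (card (UNIV :: 'g set)):]"
  proof -
    have "(\<Sum>w\<in>verts Y. f ?v * [:S w / of_nat (card (UNIV :: 'g set)):]) = f ?v * [:(\<Sum>w\<in>verts Y. S w) / of_nat (card (UNIV :: 'g set)):]" for S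
      by (simp add: sum_divide_distrib smult_sum)
    then show ?thesis .
  qed
  \<comment> \<open>For each group element exactly one vertex is moved to \<open>?v\<close>, so the
    double sum counts the group.\<close>
  also have "(\<Sum>w\<in>verts Y. \<Sum>g\<in>(UNIV :: 'g set). if actV g w = ?v then 1 else 0 :: complex)
      = (\<Sum>g\<in>(UNIV :: 'g set). \<Sum>w\<in>verts Y. if w = actV (- g) ?v then 1 else 0)"
    using actV_eq_iff[OF _ v, of _ _ 0] actV_zero[OF v]
    by (subst sum.swap) (auto intro!: sum.cong)
  also have "\<dots> = of_nat (card (UNIV :: 'g set))" using v by (simp add: actV_closed)
  finally show ?thesis by (simp flip: one_pCons)
qed

text \<open>Arc reversal exchanges the arcs ending in \<open>v\<close> with those starting there, so
  the column sums of the adjacency matrix are valencies as well.\<close>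

lemma sum_num_arcs_left:
  assumes "v \<in> verts Y"
  shows "(\<Sum>w\<in>verts Y. num_arcs w v) = of_nat (out_degree Y v)"
proof -
  have "(\<Sum>w\<in>verts Y. num_arcs w v) = (\<Sum>w\<in>verts Y. \<Sum>e\<in>out_arcs Y w. if head Y e = v then 1 else 0)"
    by (simp add: num_arcs_def sum.inter_filter[symmetric] finite_out_arcs del: in_out_arcs_conv)
  also have "\<dots> = (\<Sum>e\<in>arcs Y. if head Y e = v then 1 else 0)" by (rule sum_out_arcs)
  also have "\<dots> = (\<Sum>e\<in>arcs Y. if tail Y e = v then 1 else 0)"
    by (subst sum_arcs_bar[symmetric]) (auto intro!: sum.cong)
  also have "\<dots> = of_nat (out_degree Y v)"
    by (simp add: sum.If_cases out_degree_def out_arcs_def Int_def)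
  finally show ?thesis .
qed

text \<open>Let \<open>1\<close> be the row vector of ones and \<open>r\<close> the row of column
  sums of \<open>ihara_mat\<close>. Both are invariant under the group, so the projector fixes them
  from the right: \<open>1 - E\<close> contributes 0 and \<open>F E\<close> contributes
  \<open>r\<close>, whose entries factor as stated.\<close>

lemma col_sum_twisted_mat:
  assumes l: "l < length vs"
  shows "(\<Sum>m<length vs. twisted_mat trivial_character $$ (m, l))
    = [:1, -1:] * [:1, 1 - of_nat (out_degree Y (vs ! l)):]"
proof -
  let ?E = "char_proj trivial_character"
  define r :: "'v \<Rightarrow> complex poly" where "r w = [:1, - of_nat (out_degree Y w), of_nat (out_degree Y w) - 1:]" for w
  have col_F: "(\<Sum>m<length vs. ihara_mat $$ (m, k)) = r (vs ! k)" if k: "k < length vs" for k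
  proof -
    have "(\<Sum>m<length vs. num_arcs (vs ! m) (vs ! k)) = of_nat (out_degree Y (vs ! k))"
      using sum_num_arcs_left[OF vs_in_verts[OF k]] sum_vs[of "\<lambda>w. num_arcs w (vs ! k)"] by simp
    moreover have "(\<Sum>m<length vs. ihara_mat $$ (m, k)) = [: \<Sum>m<length vs. of_bool (m = k),
        - (\<Sum>m<length vs. num_arcs (vs ! m) (vs ! k)),
        \<Sum>m<length vs. of_bool (m = k) * (of_nat (out_degree Y (vs ! m)) - 1) :]"
      using k by (simp add: ihara_mat_def sum_pCons3 sum_negf)
    moreover have "(\<Sum>m<length vs. of_bool (m = k)) = (1 :: complex)"
      "(\<Sum>m<length vs. of_bool (m = k) * (of_nat (out_degree Y (vs ! m)) - 1))
        = (of_nat (out_degree Y (vs ! k)) - 1 :: complex)"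
      using k by (simp_all add: of_bool_def if_distrib[of "\<lambda>c. c * _"] cong: if_cong)
    ultimately show ?thesis by (simp add: r_def)
  qed
  have "(\<Sum>m<length vs. twisted_mat trivial_character $$ (m, l))
      = (\<Sum>m<length vs. of_bool (m = l) - [:?E $$ (m, l):] + (\<Sum>k<length vs. ihara_mat $$ (m, k) * [:?E $$ (k, l):]))"
    using l ihara_mat_carrier char_proj_carrier[of trivial_character]
    by (intro sum.cong) (auto simp: scalar_prod_def lessThan_atLeast0)
  also have "\<dots> = 1 - (\<Sum>m<length vs. 1 * [:?E $$ (m, l):])
      + (\<Sum>m<length vs. \<Sum>k<length vs. ihara_mat $$ (m, k) * [:?E $$ (k, l):])"
    using l by (simp add: sum.distrib sum_subtractf of_bool_def)
  also have "(\<Sum>m<length vs. \<Sum>k<length vs. ihara_mat $$ (m, k) * [:?E $$ (k, l):])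
      = (\<Sum>k<length vs. (\<Sum>m<length vs. ihara_mat $$ (m, k)) * [:?E $$ (k, l):])"
    by (subst sum.swap) (simp only: sum_distrib_right)
  also have "\<dots> = (\<Sum>k<length vs. r (vs ! k) * [:?E $$ (k, l):])"
    by (rule sum.cong) (auto simp: col_F)
  also have "\<dots> = r (vs ! l)"
    using l by (rule sum_invariant_char_proj) (simp add: r_def out_degree_actV)
  also have "(\<Sum>m<length vs. 1 * [:?E $$ (m, l):]) = 1"
    using l by (rule sum_invariant_char_proj[of l "\<lambda>_. 1"]) simp
  finally show ?thesis by (simp add: r_def)
qed

text \<open>The handshake count: the valencies add up to the number of arcs, twice the number of
  edges.\<close>

lemma sum_two_minus_degree:
  "(\<Sum>w\<in>verts Y. 2 - of_nat (out_degree Y w)) = (2 * of_int (euler_char Y bar) :: complex)"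
proof -
  have "(\<Sum>w\<in>verts Y. out_degree Y w) = card (arcs Y)"
    using sum_out_arcs[of "\<lambda>_. 1 :: nat"] by (simp add: out_degree_def)
  then have "(\<Sum>w\<in>verts Y. of_nat (out_degree Y w) :: complex) = of_nat (card (arcs Y))"
    by (simp flip: of_nat_sum)
  then show ?thesis
    using card_arcs_eq[OF finite_arcs] by (simp add: sum_subtractf euler_char_def algebra_simps)
qed

text \<open>Dividing the sum of the rows by \<open>1 - u\<close> alters row 0 only. The kernel of
  the new matrix \<open>Q\<close> at \<open>u = 1\<close> lies in the kernel of the old one, which
  consists of constants, and row 0 of \<open>Q\<close> sends the constant \<open>c\<close> to
  \<open>2 \<chi>(Y) c\<close>.\<close>

lemma h_poly_trivial_factor:
  assumes conn: "Digraph_Component.connected Y" and \<chi>: "euler_char Y bar \<noteq> 0"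
  obtains q where "h_poly Y actV trivial_character = [:1, -1:] * q" "poly q 1 \<noteq> 0"
proof -
  let ?P = "twisted_mat trivial_character"
  have n: "0 < length vs"
    using conn set_vs by (auto simp: connected_conv)
  define Q where "Q = mat (length vs) (length vs) (\<lambda>(i, j).
    if i = 0 then [:1, 1 - of_nat (out_degree Y (vs ! j)):] else ?P $$ (i, j))"
  have Q: "Q \<in> carrier_mat (length vs) (length vs)" by (simp add: Q_def)
  have h: "h_poly Y actV trivial_character = [:1, -1:] * Determinant.det Q"
    unfolding h_poly_eq_det[OF is_character_trivial] Q_def
    by (rule det_col_sums_factor[OF twisted_mat_carrier n col_sum_twisted_mat])
  define A where "A = 1\<^sub>m (length vs) - char_proj trivial_character + lap_mat * char_proj trivial_character"
  have A: "A \<in> carrier_mat (length vs) (length vs)"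
    using char_proj_carrier[of trivial_character] lap_mat_carrier by (auto simp: A_def)
  have A_entry: "A $$ (i, j) = poly (?P $$ (i, j)) 1" if "i < length vs" "j < length vs" for i j
    unfolding A_def twisted_mat_at_one[symmetric] using that twisted_mat_carrier[of trivial_character] by (intro index_map_mat) auto
  have col: "(\<Sum>i<length vs. A $$ (i, j)) = 0" if j: "j < length vs" for j
  proof -
    have "(\<Sum>i<length vs. A $$ (i, j)) = poly (\<Sum>i<length vs. ?P $$ (i, j)) 1"
      using j by (simp add: A_entry poly_sum del: index_add_mat index_minus_mat index_mult_mat)
    then show ?thesis unfolding col_sum_twisted_mat[OF j] by simp
  qed
  have "poly (Determinant.det Q) 1 \<noteq> 0"
  proof
    let ?Q = "map_mat (\<lambda>p. poly p 1) Q"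
    assume "poly (Determinant.det Q) 1 = 0"
    then have "Determinant.det ?Q = 0" by (simp only: comm_ring_hom.hom_det[OF poly_hom.comm_ring_hom_axioms])
    moreover have "?Q \<in> carrier_mat (length vs) (length vs)" using Q by simp
    ultimately obtain x where x: "x \<in> carrier_vec (length vs)" "x \<noteq> 0\<^sub>v (length vs)" and Qx: "?Q *\<^sub>v x = 0\<^sub>v (length vs)"
      using det_0_iff_vec_prod_zero by blast
    have row: "(\<Sum>j<length vs. ?Q $$ (i, j) * x $ j) = 0" if "i < length vs" for i
      using arg_cong[OF Qx, of "\<lambda>v. v $ i"] that x(1) Q
      by (simp add: scalar_prod_def lessThan_atLeast0)
    have Ax: "(\<Sum>j<length vs. A $$ (i, j) * x $ j) = 0" if "i < length vs" "i \<noteq> 0" for i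
    proof -
      have "(\<Sum>j<length vs. A $$ (i, j) * x $ j) = (\<Sum>j<length vs. ?Q $$ (i, j) * x $ j)"
        using that by (intro sum.cong) (simp_all add: A_entry Q_def)
      then show ?thesis using row that by simp
    qed
    \<comment> \<open>The rows of \<open>A\<close> add up to zero, so the equation for row 0,
      replaced in \<open>Q\<close>, follows from the others.\<close>
    have "0 = (\<Sum>j<length vs. (\<Sum>i<length vs. A $$ (i, j)) * x $ j)" by (simp add: col)
    also have "\<dots> = (\<Sum>i<length vs. \<Sum>j<length vs. A $$ (i, j) * x $ j)"
      by (subst sum.swap) (simp only: sum_distrib_right)
    also have "\<dots> = (\<Sum>i\<in>{0}. \<Sum>j<length vs. A $$ (i, j) * x $ j)"
      using n Ax by (intro sum.mono_neutral_right) auto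
    finally have "(\<Sum>j<length vs. A $$ (0, j) * x $ j) = 0" by simp
    with Ax have "(\<Sum>j<length vs. A $$ (i, j) * x $ j) = 0" if "i < length vs" for i
      using that by (cases "i = 0") auto
    then have "A *\<^sub>v x = 0\<^sub>v (length vs)"
      using A x(1) by (intro eq_vecI) (auto simp: scalar_prod_def lessThan_atLeast0)
    then obtain c where c: "x = vert_vec (\<lambda>_. c)"
      unfolding A_def by (rule kernel_at_one[OF conn is_character_trivial x(1)])
    \<comment> \<open>At \<open>u = 1\<close> the cofactor \<open>[:1, 1 - d:]\<close> in row 0
      takes the value \<open>2 - d\<close>.\<close>
    have "0 = (\<Sum>j<length vs. (2 - of_nat (out_degree Y (vs ! j))) * c)"
      using row[OF n] n by (simp add: Q_def c vert_vec_def)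
    also have "\<dots> = 2 * of_int (euler_char Y bar) * c"
      unfolding sum_distrib_right[symmetric] sum_vs[of "\<lambda>w. 2 - of_nat (out_degree Y w)"]
        sum_two_minus_degree ..
    finally have "c = 0" using \<chi> by simp
    then show False using x(2) c by (simp add: vert_vec_def vec_eq_iff)
  qed
  with h show thesis by (rule that)
qed

end

theorem theorem6p2:
  fixes Y :: "('v, 'e) pre_digraph"
    and bar :: "'e \<Rightarrow> 'e"
    and actV :: "'g::{finite, ab_group_add} \<Rightarrow> 'v \<Rightarrow> 'v"
    and actE :: "'g \<Rightarrow> 'e \<Rightarrow> 'e"
  assumes "fin_digraph Y"
    and "bidirected_digraph Y bar"
    and "Digraph_Component.connected Y"
    and "graph_action Y bar actV actE"
    and "without_inversion Y bar actE"
    and "free_on_arcs Y actE"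
    and "euler_char Y bar \<noteq> 0"
  shows "(\<forall>\<psi>. is_character \<psi> \<and> \<psi> \<noteq> trivial_character \<longrightarrow> ord_at 1 (h_poly Y actV \<psi>) = 0)
    \<and> ord_at 1 (h_poly Y actV trivial_character) = 1"
proof -
  interpret fin_digraph Y by (rule assms(1))
  obtain vs where vs: "distinct vs" "set vs = verts Y"
    using finite_distinct_list[OF finite_verts] by blast
  interpret finite_graph_action Y bar actV actE vs
    using assms(1,4) vs by (intro finite_graph_action.intro finite_graph_action_axioms.intro)
  have "ord_at 1 (h_poly Y actV \<psi>) = 0" if "is_character \<psi>" "\<psi> \<noteq> trivial_character" for \<psi>
  proof -
    have "poly (h_poly Y actV \<psi>) 1 \<noteq> 0"
      using h_poly_nontrivial_at_one assms(3) that by blast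
    then show ?thesis by (auto simp: ord_at_def order_0I zero_enat_def)
  qed
  moreover have "ord_at 1 (h_poly Y actV trivial_character) = 1"
  proof -
    obtain q where h: "h_poly Y actV trivial_character = [:1, -1:] * q" and q: "poly q 1 \<noteq> 0"
      using h_poly_trivial_factor assms(3,7) by blast
    \<comment> \<open>The sign moves to \<open>q\<close> so that the linear factor is the monic one,
      whose power measures the order at 1.\<close>
    have h': "h_poly Y actV trivial_character = [:-1, 1:] ^ 1 * (- q)" using h by simp
    have nz: "h_poly Y actV trivial_character \<noteq> 0" unfolding h using q by (intro no_zero_divisors) auto
    then have "Polynomial.order 1 (h_poly Y actV trivial_character)
        = Polynomial.order 1 ([:-1, 1:] ^ 1 :: complex poly) + Polynomial.order 1 (- q)"
      unfolding h' by (rule order_mult)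
    also have "\<dots> = 1"
      using order_power_n_n[of "1 :: complex" 1] q by (simp add: order_0I)
    finally show ?thesis using nz by (simp add: ord_at_def one_enat_def)
  qed
  ultimately show ?thesis by blast
qed

end
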